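(* Let $R$ be an EPRF-TRS and $S$ be a TRS over a ranked alphabet $\Sigma$. Let $g\in\Sigma-(sign(R)\cup\Sigma_0)$ and let $\sharp\in\Sigma_0$ be irreducible for $R$. Then it is decidable whether $\Rightarrow^*_S\cap(T_\Sigma\times T_\Sigma)\subseteq\Rightarrow^*_R\cap(T_\Sigma\times T_\Sigma)$.
   Context: A ranked alphabet $\Sigma$ is a finite set of symbols with ranks, $\Sigma_0$ its constants; $X$ a countable set of variables, $T_\Sigma(X)$ the terms, $T_\Sigma$ the ground terms. A TRS $R$ over $\Sigma$ is a finite set of rules $l\to r$, $l,r\in T_\Sigma(X)$, with every variable of $r$ occurring in $l$; $\Rightarrow^*_R$ is the reflexive transitive closure of its rewrite relation; $sign(R)$ is the set of symbols in its rules; a term is irreducible for $R$ if no rule of $R$ applies to it. $R^*_\Gamma(L)=\{p\mid q\Rightarrow^*_R p,\ q\in L\}$. A bottom-up tree automaton (bta) over $\Gamma$ is a finite automaton with states (treated as constants), final states, rules $\delta(a_1,\dots,a_n)\to a$ and $a\to a'$, recognizing the ground terms rewriting to a final state. $R$ is an EPRF-TRS if for any given ranked alphabet $\Gamma\supseteq sign(R)$ and finite $L\subseteq T_\Gamma$ one can effectively construct a bta $\mathcal{C}$ over $\Gamma$ with $L(\mathcal{C})=R^*_\Gamma(L)$. *)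

theory Defs
  imports Main "HOL-Library.Nat_Bijection"
begin

section \<open>Terms, ranked alphabets, term rewriting systems\<close>

datatype (names: 'f, vars: 'v) trm = Var 'v | Fun 'f "('f, 'v) trm list"

text \<open>A ranked symbol is a pair of a name and its rank; an alphabet assigns one rank to each name.\<close>

type_synonym 'f ranked = "'f \<times> nat"

definition ranked_alphabet :: "'f ranked set \<Rightarrow> bool" where
  "ranked_alphabet \<Sigma> \<longleftrightarrow> finite \<Sigma> \<and> single_valued \<Sigma>"

definition constants :: "'f ranked set \<Rightarrow> 'f ranked set" where
  "constants \<Sigma> = {s \<in> \<Sigma>. snd s = 0}"

inductive_set terms :: "'f ranked set \<Rightarrow> ('f, 'v) trm set" for \<Sigma> where
  "Var x \<in> terms \<Sigma>"
| "(f, length ts) \<in> \<Sigma> \<Longrightarrow> (\<forall>t \<in> set ts. t \<in> terms \<Sigma>) \<Longrightarrow> Fun f ts \<in> terms \<Sigma>"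

definition ground_terms :: "'f ranked set \<Rightarrow> ('f, 'v) trm set" where
  "ground_terms \<Sigma> = {t \<in> terms \<Sigma>. vars t = {}}"

primrec subst :: "('v \<Rightarrow> ('f, 'w) trm) \<Rightarrow> ('f, 'v) trm \<Rightarrow> ('f, 'w) trm" where
  "subst \<sigma> (Var x) = \<sigma> x"
| "subst \<sigma> (Fun f ts) = Fun f (map (subst \<sigma>) ts)"

type_synonym ('f, 'v) rule = "('f, 'v) trm \<times> ('f, 'v) trm"

definition trs :: "'f ranked set \<Rightarrow> ('f, 'v) rule set \<Rightarrow> bool" where
  "trs \<Sigma> R \<longleftrightarrow> finite R \<and> (\<forall>(l, r) \<in> R. l \<in> terms \<Sigma> \<and> r \<in> terms \<Sigma> \<and> vars r \<subseteq> vars l)"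

primrec symbols :: "('f, 'v) trm \<Rightarrow> 'f ranked set" where
  "symbols (Var x) = {}"
| "symbols (Fun f ts) = insert (f, length ts) (\<Union>(set (map symbols ts)))"

definition sign :: "('f, 'v) rule set \<Rightarrow> 'f ranked set" where
  "sign R = (\<Union>(l, r) \<in> R. symbols l \<union> symbols r)"

inductive_set rstep :: "('f, 'v) rule set \<Rightarrow> ('f, 'v) trm rel" for R where
  root: "(l, r) \<in> R \<Longrightarrow> (subst \<sigma> l, subst \<sigma> r) \<in> rstep R"
| arg: "(s, t) \<in> rstep R \<Longrightarrow> (Fun f (us @ s # vs), Fun f (us @ t # vs)) \<in> rstep R"

definition irreducible :: "('f, 'v) rule set \<Rightarrow> ('f, 'v) trm \<Rightarrow> bool" where
  "irreducible R t \<longleftrightarrow> (\<nexists>u. (t, u) \<in> rstep R)"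

definition descendants :: "('f, 'v) rule set \<Rightarrow> ('f, 'v) trm set \<Rightarrow> ('f, 'v) trm set" where
  "descendants R L = {p. \<exists>q \<in> L. (q, p) \<in> (rstep R)\<^sup>*}"

section \<open>Bottom-up tree automata\<close>

text \<open>The components are the states, the final states, the rules
  \<open>f(q1,...,qn) \<rightarrow> q\<close> (stored as \<open>((f, [q1,...,qn]), q)\<close>) and the rules \<open>q \<rightarrow> q'\<close>.\<close>

datatype ('f, 'q) bta =
  BTA (states: "'q list") (finals: "'q list")
      (transitions: "(('f \<times> 'q list) \<times> 'q) list") (epsilons: "('q \<times> 'q) list")

definition bta_over :: "'f ranked set \<Rightarrow> ('f, 'q) bta \<Rightarrow> bool" where
  "bta_over \<Gamma> A \<longleftrightarrow>
     set (finals A) \<subseteq> set (states A) \<and>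
     (\<forall>((f, qs), q) \<in> set (transitions A).
        (f, length qs) \<in> \<Gamma> \<and> set qs \<subseteq> set (states A) \<and> q \<in> set (states A)) \<and>
     (\<forall>(q, q') \<in> set (epsilons A). q \<in> set (states A) \<and> q' \<in> set (states A))"

text \<open>States are constants disjoint from the alphabet: symbols are tagged \<open>Inl\<close>, states \<open>Inr\<close>.\<close>

definition state_trm :: "'q \<Rightarrow> ('f + 'q, 'v) trm" where
  "state_trm q = Fun (Inr q) []"

definition bta_rules :: "('f, 'q) bta \<Rightarrow> ('f + 'q, 'v) rule set" where
  "bta_rules A =
     {(Fun (Inl f) (map state_trm qs), state_trm q) | f qs q. ((f, qs), q) \<in> set (transitions A)} \<union>
     {(state_trm q, state_trm q') | q q'. (q, q') \<in> set (epsilons A)}"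

definition bta_lang :: "'f ranked set \<Rightarrow> ('f, 'q) bta \<Rightarrow> ('f, 'v) trm set" where
  "bta_lang \<Gamma> A =
     {t \<in> ground_terms \<Gamma>. \<exists>q \<in> set (finals A).
        (map_trm Inl id t, state_trm q) \<in> (rstep (bta_rules A))\<^sup>*}"

section \<open>Total recursive functions\<close>

text \<open>\<open>recursive n f\<close>: the restriction of \<open>f\<close> to lists of length \<open>n\<close> is a total
  (general) recursive function of \<open>n\<close> arguments. Values on lists of other lengths are irrelevant.\<close>

inductive recursive :: "nat \<Rightarrow> (nat list \<Rightarrow> nat) \<Rightarrow> bool" where
  zero: "recursive n (\<lambda>xs. 0)"
| succ: "recursive 1 (\<lambda>xs. Suc (hd xs))"
| proj: "i < n \<Longrightarrow> recursive n (\<lambda>xs. xs ! i)"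
| comp: "recursive (length gs) f \<Longrightarrow> (\<forall>g \<in> set gs. recursive n g) \<Longrightarrow>
    recursive n (\<lambda>xs. f (map (\<lambda>g. g xs) gs))"
| prim: "recursive n f \<Longrightarrow> recursive (n + 2) g \<Longrightarrow>
    recursive (n + 1) (\<lambda>xs. rec_nat (f (tl xs)) (\<lambda>y r. g (y # r # tl xs)) (hd xs))"
| mu: "recursive (n + 1) f \<Longrightarrow> (\<forall>xs. length xs = n \<longrightarrow> (\<exists>y. f (y # xs) = 0)) \<Longrightarrow>
    recursive n (\<lambda>xs. LEAST y. f (y # xs) = 0)"

definition computable :: "(nat \<Rightarrow> nat) \<Rightarrow> bool" where
  "computable c \<longleftrightarrow> (\<exists>f. recursive 1 f \<and> (\<forall>x. f [x] = c x))"

text \<open>Decidability of \<open>P\<close> for instances restricted to \<open>D\<close>, presented by their codes.\<close>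

definition decidable_on :: "('a \<Rightarrow> nat) \<Rightarrow> 'a set \<Rightarrow> ('a \<Rightarrow> bool) \<Rightarrow> bool" where
  "decidable_on code D P \<longleftrightarrow>
     (\<exists>d. computable d \<and> (\<forall>x \<in> D. d (code x) = (if P x then 1 else 0)))"

section \<open>Codes of finite objects\<close>

text \<open>Finite sets are presented by arbitrary lists of their elements.\<close>

primrec trm_code :: "(nat, nat) trm \<Rightarrow> nat" where
  "trm_code (Var x) = sum_encode (Inl x)"
| "trm_code (Fun f ts) = sum_encode (Inr (prod_encode (f, list_encode (map trm_code ts))))"

definition alphabet_code :: "nat ranked list \<Rightarrow> nat" where
  "alphabet_code \<Gamma> = list_encode (map prod_encode \<Gamma>)"

definition trms_code :: "(nat, nat) trm list \<Rightarrow> nat" where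
  "trms_code L = list_encode (map trm_code L)"

definition trs_code :: "(nat, nat) rule list \<Rightarrow> nat" where
  "trs_code S = list_encode (map (\<lambda>(l, r). prod_encode (trm_code l, trm_code r)) S)"

definition bta_code :: "(nat, nat) bta \<Rightarrow> nat" where
  "bta_code A = list_encode
     [list_encode (states A),
      list_encode (finals A),
      list_encode (map (\<lambda>((f, qs), q). list_encode [f, list_encode qs, q]) (transitions A)),
      list_encode (map prod_encode (epsilons A))]"

section \<open>EPRF-TRSs\<close>

text \<open>\<open>R\<close> is fixed, so the admissible inputs form a decidable set and a construction
  defined only on them extends to a total recursive one.\<close>

definition EPRF_TRS :: "(nat, nat) rule set \<Rightarrow> bool" where
  "EPRF_TRS R \<longleftrightarrow>
     (\<exists>\<Sigma>. ranked_alphabet \<Sigma> \<and> trs \<Sigma> R) \<and>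
     (\<exists>c. computable c \<and>
        (\<forall>\<Gamma> L. ranked_alphabet (set \<Gamma>) \<longrightarrow> sign R \<subseteq> set \<Gamma> \<longrightarrow> set L \<subseteq> ground_terms (set \<Gamma>) \<longrightarrow>
           (\<exists>A. c (prod_encode (alphabet_code \<Gamma>, trms_code L)) = bta_code A \<and>
                bta_over (set \<Gamma>) A \<and>
                bta_lang (set \<Gamma>) A = descendants R (set L))))"

end

(* Both rewrite relations are closed under contexts and substitutions. Hence the inclusion holds
   as soon as l =>*_R r for every rule l -> r of S. Conversely, instantiate the variables of a rule
   by pairwise different tall trees over g with leaves sharp. They are irreducible, R knows nothing
   about g, and R-steps never increase the nesting of g. So the trees behave like variables: every
   R-derivation between the two instances lifts to one from l to r.
   To decide l =>*_R r, replace the variables by fresh constants instead (the EPRF property may be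
   applied to any larger alphabet), build the automaton for the descendants of the frozen l and run
   it on the frozen r. *)

theory Submission
  imports Defs
begin

section \<open>Recursive functions\<close>

text \<open>Two families of ground terms replace variables, and one lifting lemma,
  \<open>rsteps_of_subst\<close>, serves both. The inclusion speaks only of ground terms over
  \<Sigma>, so there the variables must be modelled inside \<Sigma>. As \<Sigma> may offer a single
  constant, the models are told apart by height, which takes a symbol g of positive rank. The
  procedure may enlarge the alphabet, so there constants suffice. The obstacle to lifting is
  nonlinear left sides: such a rule tests subterms for equality, so different terms must keep
  different instances. Trees over g can imitate each other because the rules of S may contain g.
  Spacing the heights by more than the nesting of g in the rule at hand prevents this, and since
  R-steps do not raise the nesting, the spacing stays sufficient along the whole derivation.
  Decidability refers to a concrete class of recursive functions, and the EPRF property provides a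
  function on codes. The procedure therefore needs a calculus of functions computable on codes,
  including recursion over terms.\<close>

definition rec_fun :: "nat \<Rightarrow> (nat list \<Rightarrow> nat) \<Rightarrow> bool" where
  "rec_fun n F \<longleftrightarrow> (\<exists>f. recursive n f \<and> (\<forall>xs. length xs = n \<longrightarrow> f xs = F xs))"

lemma rec_fun_recursive: "recursive n f \<Longrightarrow> rec_fun n f"
  by (auto simp: rec_fun_def)

text \<open>The rules of \<open>recursive\<close> yield particular functions, with accidental values
  at lists of other lengths. Passing to agreement at length \<open>n\<close> permits
  rewriting.\<close>

lemma rec_fun_cong: "rec_fun n F \<Longrightarrow> (\<And>xs. length xs = n \<Longrightarrow> F xs = G xs) \<Longrightarrow> rec_fun n G"
  unfolding rec_fun_def by metis

lemma rec_fun_comp: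
  assumes "rec_fun (length Gs) F" "\<And>G. G \<in> set Gs \<Longrightarrow> rec_fun n G"
  shows "rec_fun n (\<lambda>xs. F (map (\<lambda>G. G xs) Gs))"
proof -
  obtain f where f: "recursive (length Gs) f" "\<And>xs. length xs = length Gs \<Longrightarrow> f xs = F xs"
    using assms(1) by (auto simp: rec_fun_def)
  have "\<forall>G\<in>set Gs. \<exists>g. recursive n g \<and> (\<forall>xs. length xs = n \<longrightarrow> g xs = G xs)"
    using assms(2) by (auto simp: rec_fun_def)
  then obtain h where h: "\<And>G. G \<in> set Gs \<Longrightarrow> recursive n (h G)"
    "\<And>G xs. G \<in> set Gs \<Longrightarrow> length xs = n \<Longrightarrow> h G xs = G xs"
    by (metis (no_types, lifting))
  have "recursive n (\<lambda>xs. f (map (\<lambda>g. g xs) (map h Gs)))"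
    using f(1) h(1) by (intro recursive.comp) auto
  moreover have "f (map (\<lambda>g. g xs) (map h Gs)) = F (map (\<lambda>G. G xs) Gs)" if "length xs = n" for xs
  proof -
    have "map (\<lambda>g. g xs) (map h Gs) = map (\<lambda>G. G xs) Gs"
      using h(2) that by simp
    then show ?thesis using f(2) by (simp del: map_map)
  qed
  ultimately show ?thesis by (auto simp: rec_fun_def)
qed

lemma rec_fun_comp1: "rec_fun 1 (\<lambda>xs. F (xs ! 0)) \<Longrightarrow> rec_fun n G \<Longrightarrow> rec_fun n (\<lambda>xs. F (G xs))"
  using rec_fun_comp[of "[G]" "\<lambda>xs. F (xs ! 0)" n] by simp

lemma rec_fun_comp2:
  "rec_fun 2 (\<lambda>xs. F (xs ! 0) (xs ! 1)) \<Longrightarrow> rec_fun n G \<Longrightarrow> rec_fun n H \<Longrightarrow> rec_fun n (\<lambda>xs. F (G xs) (H xs))"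
  using rec_fun_comp[of "[G, H]" "\<lambda>xs. F (xs ! 0) (xs ! 1)" n]
  by (auto simp: numeral_2_eq_2)

lemma rec_fun_proj: "i < n \<Longrightarrow> rec_fun n (\<lambda>xs. xs ! i)"
  by (intro rec_fun_recursive recursive.proj)

lemma rec_fun_rec:
  assumes "rec_fun n F" "rec_fun (n + 2) G"
  shows "rec_fun (n + 1) (\<lambda>xs. rec_nat (F (tl xs)) (\<lambda>y r. G (y # r # tl xs)) (hd xs))"
proof -
  obtain f where f: "recursive n f" "\<And>xs. length xs = n \<Longrightarrow> f xs = F xs"
    using assms(1) by (auto simp: rec_fun_def)
  obtain g where g: "recursive (n + 2) g" "\<And>xs. length xs = n + 2 \<Longrightarrow> g xs = G xs"
    using assms(2) by (auto simp: rec_fun_def)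
  have "rec_nat (f (tl xs)) (\<lambda>y r. g (y # r # tl xs)) k = rec_nat (F (tl xs)) (\<lambda>y r. G (y # r # tl xs)) k"
    if "length xs = n + 1" for xs k
    using that f(2)[of "tl xs"] g(2) by (induction k) auto
  with recursive.prim[OF f(1) g(1)] show ?thesis
    unfolding rec_fun_def by blast
qed

lemma rec_fun_mu:
  assumes "rec_fun (n + 1) F" "\<And>xs. length xs = n \<Longrightarrow> \<exists>y. F (y # xs) = 0"
  shows "rec_fun n (\<lambda>xs. LEAST y. F (y # xs) = 0)"
proof -
  obtain f where f: "recursive (n + 1) f" "\<And>xs. length xs = n + 1 \<Longrightarrow> f xs = F xs"
    using assms(1) by (auto simp: rec_fun_def)
  then have "recursive n (\<lambda>xs. LEAST y. f (y # xs) = 0)"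
    using assms(2) by (intro recursive.mu) auto
  moreover have "(LEAST y. f (y # xs) = 0) = (LEAST y. F (y # xs) = 0)" if "length xs = n" for xs
    using f(2) that by simp
  ultimately show ?thesis
    unfolding rec_fun_def by blast
qed

lemma rec_fun_zero: "rec_fun n (\<lambda>xs. 0)"
  by (intro rec_fun_recursive recursive.zero)

lemma rec_fun_Suc: "rec_fun n F \<Longrightarrow> rec_fun n (\<lambda>xs. Suc (F xs))"
  by (rule rec_fun_comp1[of Suc, OF rec_fun_cong[OF rec_fun_recursive[OF recursive.succ]]])
    (auto simp: length_Suc_conv)

lemma rec_fun_rec_nat2:
  assumes "rec_fun 1 (\<lambda>xs. f (xs ! 0))" "rec_fun 3 (\<lambda>xs. g (xs ! 0) (xs ! 1) (xs ! 2))"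
  shows "rec_fun 2 (\<lambda>xs. rec_nat (f (xs ! 1)) (\<lambda>y r. g y r (xs ! 1)) (xs ! 0))"
  using rec_fun_rec[of 1 "\<lambda>xs. f (xs ! 0)" "\<lambda>xs. g (xs ! 0) (xs ! 1) (xs ! 2)"] assms
  by (auto simp: numeral_3_eq_3 numeral_2_eq_2 length_Suc_conv elim!: rec_fun_cong)

lemma rec_fun_rec_nat1:
  assumes "rec_fun 2 (\<lambda>xs. g (xs ! 0) (xs ! 1))"
  shows "rec_fun 1 (\<lambda>xs. rec_nat 0 g (xs ! 0))"
  using rec_fun_rec[OF rec_fun_zero, of 0 "\<lambda>xs. g (xs ! 0) (xs ! 1)"] assms
  by (auto simp: numeral_2_eq_2 length_Suc_conv elim!: rec_fun_cong)

section \<open>Arithmetic and the pairing function\<close>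

lemma rec_fun_add: "rec_fun n F \<Longrightarrow> rec_fun n G \<Longrightarrow> rec_fun n (\<lambda>xs. F xs + G xs)"
proof (rule rec_fun_comp2[of "(+)"])
  have eq: "rec_nat b (\<lambda>y r. Suc r) a = a + b" for a b :: nat
    by (induction a) auto
  show "rec_fun 2 (\<lambda>xs. xs ! 0 + xs ! 1)"
    using rec_fun_rec_nat2[of "\<lambda>x. x" "\<lambda>y r x. Suc r"] by (simp add: eq rec_fun_proj rec_fun_Suc)
qed

lemma rec_fun_pred: "rec_fun n F \<Longrightarrow> rec_fun n (\<lambda>xs. F xs - 1)"
proof (rule rec_fun_comp1[of "\<lambda>x. x - 1"])
  have eq: "rec_nat 0 (\<lambda>y r. y) a = a - 1" for a :: nat
    by (cases a) auto
  show "rec_fun 1 (\<lambda>xs. xs ! 0 - 1)"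
    using rec_fun_rec_nat1[of "\<lambda>y r. y"] by (simp add: eq rec_fun_proj)
qed

lemma rec_fun_diff: "rec_fun n F \<Longrightarrow> rec_fun n G \<Longrightarrow> rec_fun n (\<lambda>xs. F xs - G xs)"
\<comment> \<open>The recursion runs along the first argument and iterates the predecessor, so the
  subtrahend comes first.\<close>
proof (rule rec_fun_comp2[of "\<lambda>b a. a - b"])
  have eq: "rec_nat b (\<lambda>y r. r - 1) a = b - a" for a b :: nat
    by (induction a) auto
  show "rec_fun 2 (\<lambda>xs. xs ! 1 - xs ! 0)"
    using rec_fun_rec_nat2[of "\<lambda>x. x" "\<lambda>y r x. r - 1", unfolded eq]
    by (simp add: rec_fun_proj rec_fun_pred[simplified])
qed

lemma rec_fun_triangle: "rec_fun n F \<Longrightarrow> rec_fun n (\<lambda>xs. triangle (F xs))"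
proof (rule rec_fun_comp1[of triangle])
  have eq: "rec_nat 0 (\<lambda>y r. r + Suc y) a = triangle a" for a :: nat
    by (induction a) auto
  have "rec_fun 2 (\<lambda>xs. xs ! 1 + Suc (xs ! 0))"
    by (intro rec_fun_add rec_fun_Suc rec_fun_proj) auto
  from rec_fun_rec_nat1[OF this] show "rec_fun 1 (\<lambda>xs. triangle (xs ! 0))"
    by (simp only: eq)
qed

lemma rec_fun_prod_encode:
  "rec_fun n F \<Longrightarrow> rec_fun n G \<Longrightarrow> rec_fun n (\<lambda>xs. prod_encode (F xs, G xs))"
  unfolding prod_encode_def prod.case by (intro rec_fun_add rec_fun_triangle)

text \<open>The index \<open>a + b\<close> of the diagonal on which \<open>prod_encode\<close> places \<open>(a, b)\<close>.\<close>

definition diagonal :: "nat \<Rightarrow> nat" where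
  "diagonal z = (LEAST s. Suc z - triangle (Suc s) = 0)"

text \<open>The code is \<open>triangle (a + b) + a\<close>, which lies in the interval from
  \<open>triangle (a + b)\<close> up to but excluding \<open>triangle (Suc (a + b))\<close>. The
  condition in \<open>diagonal\<close> expresses \<open>z < triangle (Suc s)\<close> by truncated
  subtraction.\<close>

lemma diagonal_prod_encode: "diagonal (prod_encode (a, b)) = a + b"
  unfolding diagonal_def
proof (rule Least_equality)
  show "Suc (prod_encode (a, b)) - triangle (Suc (a + b)) = 0"
    by (simp add: prod_encode_def)
next
  have mono: "triangle m \<le> triangle (m + k)" for m k
    by (induction k) auto
  fix s assume s: "Suc (prod_encode (a, b)) - triangle (Suc s) = 0"
  show "a + b \<le> s"
  proof (rule ccontr)
    assume "\<not> a + b \<le> s"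
    then have "triangle (Suc s) \<le> triangle (a + b)"
      using mono[of "Suc s" "a + b - Suc s"] by (simp only: le_add_diff_inverse not_le Suc_le_eq)
    then show False using s by (simp add: prod_encode_def del: triangle_Suc)
  qed
qed

lemma rec_fun_diagonal: "rec_fun n F \<Longrightarrow> rec_fun n (\<lambda>xs. diagonal (F xs))"
proof (rule rec_fun_comp1[of diagonal])
  have "rec_fun 2 (\<lambda>xs. Suc (xs ! 1) - triangle (Suc (xs ! 0)))"
    by (intro rec_fun_diff rec_fun_Suc rec_fun_proj rec_fun_triangle) auto
  moreover have "\<exists>y. Suc (xs ! 0) - triangle (Suc y) = 0" for xs :: "nat list"
    by (rule exI[of _ "xs ! 0"]) simp
  ultimately show "rec_fun 1 (\<lambda>xs. diagonal (xs ! 0))"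
    using rec_fun_mu[of 1 "\<lambda>xs. Suc (xs ! 1) - triangle (Suc (xs ! 0))"]
    by (simp add: diagonal_def numeral_2_eq_2)
qed

lemma fst_prod_decode: "fst (prod_decode z) = z - triangle (diagonal z)"
proof -
  obtain a b where "z = prod_encode (a, b)"
    by (metis prod_decode_inverse surj_pair)
  then show ?thesis
    by (simp add: diagonal_prod_encode) (simp add: prod_encode_def)
qed

lemma snd_prod_decode: "snd (prod_decode z) = diagonal z - fst (prod_decode z)"
proof -
  obtain a b where "z = prod_encode (a, b)"
    by (metis prod_decode_inverse surj_pair)
  then show ?thesis
    by (simp add: diagonal_prod_encode)
qed

section \<open>Computable functions of one argument\<close>

lemma computable_iff: "computable c \<longleftrightarrow> rec_fun 1 (\<lambda>xs. c (xs ! 0))"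
proof
  assume "computable c"
  then obtain f where "recursive 1 f" "\<And>x. f [x] = c x" by (auto simp: computable_def)
  then show "rec_fun 1 (\<lambda>xs. c (xs ! 0))"
    by (auto simp: rec_fun_def length_Suc_conv intro!: exI[of _ f])
next
  assume "rec_fun 1 (\<lambda>xs. c (xs ! 0))"
  then obtain f where "recursive 1 f" "\<And>xs. length xs = 1 \<Longrightarrow> f xs = c (xs ! 0)"
    by (auto simp: rec_fun_def)
  then show "computable c"
    unfolding computable_def by (intro exI[of _ f]) simp
qed

lemma rec_fun_computable: "computable c \<Longrightarrow> rec_fun n F \<Longrightarrow> rec_fun n (\<lambda>xs. c (F xs))"
  unfolding computable_iff by (rule rec_fun_comp1)

lemma computable_comp: "computable f \<Longrightarrow> computable g \<Longrightarrow> computable (\<lambda>x. f (g x))"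
  unfolding computable_iff[of g] computable_iff[of "\<lambda>x. f (g x)"] by (rule rec_fun_computable)

lemma computable_id: "computable (\<lambda>x. x)"
  unfolding computable_iff by (rule rec_fun_proj) simp

lemma computable_const: "computable (\<lambda>x. k)"
  unfolding computable_iff by (induction k) (auto intro: rec_fun_zero rec_fun_Suc)

lemma computable_Suc: "computable f \<Longrightarrow> computable (\<lambda>x. Suc (f x))"
  unfolding computable_iff by (rule rec_fun_Suc)

lemma computable_add: "computable f \<Longrightarrow> computable g \<Longrightarrow> computable (\<lambda>x. f x + g x)"
  unfolding computable_iff by (rule rec_fun_add)

lemma computable_diff: "computable f \<Longrightarrow> computable g \<Longrightarrow> computable (\<lambda>x. f x - g x)"
  unfolding computable_iff by (rule rec_fun_diff)

lemma computable_prod_encode: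
  "computable f \<Longrightarrow> computable g \<Longrightarrow> computable (\<lambda>x. prod_encode (f x, g x))"
  unfolding computable_iff by (rule rec_fun_prod_encode)

lemma computable_fst_prod_decode: "computable f \<Longrightarrow> computable (\<lambda>x. fst (prod_decode (f x)))"
  unfolding computable_iff fst_prod_decode
  by (intro rec_fun_diff rec_fun_triangle rec_fun_diagonal)

lemma computable_snd_prod_decode: "computable f \<Longrightarrow> computable (\<lambda>x. snd (prod_decode (f x)))"
  unfolding snd_prod_decode
  by (intro computable_diff computable_fst_prod_decode)
    (auto simp: computable_iff intro: rec_fun_diagonal)

text \<open>Packing parameter, counter and previous value into one code lets a unary
  \<open>g\<close> act as step function. All later constructions can then stay with unary
  functions.\<close>

lemma computable_rec_nat:
  assumes "computable f" "computable g" "computable n"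
  shows "computable (\<lambda>x. rec_nat (f x) (\<lambda>y r. g (prod_encode (x, prod_encode (y, r)))) (n x))"
proof -
  have "rec_fun 3 (\<lambda>xs. g (prod_encode (xs ! 2, prod_encode (xs ! 0, xs ! 1))))"
    by (intro rec_fun_computable[OF assms(2)] rec_fun_prod_encode rec_fun_proj) auto
  moreover have "rec_fun 1 (\<lambda>xs. f (xs ! 0))"
    using assms(1) by (simp add: computable_iff)
  ultimately have "rec_fun 2 (\<lambda>xs. rec_nat (f (xs ! 1))
      (\<lambda>y r. g (prod_encode (xs ! 1, prod_encode (y, r)))) (xs ! 0))"
    by (intro rec_fun_rec_nat2)
  then show ?thesis
    unfolding computable_iff
    using rec_fun_comp2[where n = 1 and G = "\<lambda>xs. n (xs ! 0)" and H = "\<lambda>xs. xs ! 0"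
      and F = "\<lambda>k x. rec_nat (f x) (\<lambda>y r. g (prod_encode (x, prod_encode (y, r)))) k"]
      assms(3)[unfolded computable_iff] by (simp add: rec_fun_proj)
qed

section \<open>Computability on encoded data\<close>

text \<open>The functions on terms used by the procedure, \<open>freeze\<close> and
  \<open>run\<close>, are instances of this fold, so that \<open>cmp_tfold\<close> covers
  both.\<close>

primrec tfold :: "('v \<Rightarrow> 'b) \<Rightarrow> ('f \<Rightarrow> 'b list \<Rightarrow> 'b) \<Rightarrow> ('f, 'v) trm \<Rightarrow> 'b" where
  "tfold F G (Var x) = F x"
| "tfold F G (Fun f ts) = G f (map (tfold F G) ts)"

text \<open>No injectivity is required of \<open>enc\<close>: computability of a function only asks for some
  computable map on codes that commutes with the encodings.\<close>

class enc =
  fixes enc :: "'a \<Rightarrow> nat"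

instantiation nat :: enc
begin
definition enc_nat_def [simp]: "enc (n :: nat) = n"
instance ..
end

instantiation bool :: enc
begin
definition enc_bool_def: "enc (b :: bool) = (if b then 1 else 0)"
instance ..
end

instantiation prod :: (enc, enc) enc
begin
definition enc_prod_def: "enc p = prod_encode (enc (fst p), enc (snd p))"
instance ..
end

instantiation list :: (enc) enc
begin
definition enc_list_def: "enc xs = list_encode (map enc xs)"
instance ..
end

instantiation trm :: (enc, enc) enc
begin
definition enc_trm_def: "enc t = tfold (\<lambda>x. sum_encode (Inl (enc x)))
  (\<lambda>f cs. sum_encode (Inr (prod_encode (enc f, list_encode cs)))) t"
instance ..
end

lemma enc_Pair [simp]: "enc (a, b) = prod_encode (enc a, enc b)"
  by (simp add: enc_prod_def)

lemma enc_Nil [simp]: "enc [] = 0"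
  by (simp add: enc_list_def)

lemma enc_Cons [simp]: "enc (x # xs) = Suc (prod_encode (enc x, enc xs))"
  by (simp add: enc_list_def)

lemma enc_nat_list: "enc (xs :: nat list) = list_encode xs"
  by (simp add: enc_list_def map_idI)

lemma enc_Var: "enc (Var x :: ('f::enc, 'v::enc) trm) = 2 * enc x"
  by (simp add: enc_trm_def sum_encode_def)

lemma enc_Fun: "enc (Fun f ts :: ('f::enc, 'v::enc) trm) = Suc (2 * prod_encode (enc f, enc ts))"
  by (simp add: enc_trm_def sum_encode_def enc_list_def cong: map_cong)

lemma enc_trm: "enc t = trm_code t"
  by (induction t) (simp_all add: enc_Var enc_Fun sum_encode_def enc_list_def cong: map_cong)

text \<open>Strict because of the \<open>Suc\<close> in the code of a cons cell. This drives both
  the recursion over codes of terms and the choice of fresh names.\<close>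

lemma enc_elem_less: "x \<in> set xs \<Longrightarrow> enc x < enc xs"
proof (induction xs)
  case (Cons y xs)
  then show ?case
    using le_prod_encode_1[of "enc y" "enc xs"] le_prod_encode_2[of "enc xs" "enc y"] by force
qed simp

lemma enc_arg_less: "t \<in> set ts \<Longrightarrow> enc t < enc (Fun f ts)"
  unfolding enc_Fun using enc_elem_less[of t ts] le_prod_encode_2[of "enc ts" "enc f"] by linarith

text \<open>Functions of several arguments are treated on nested pairs. The rules collected in
  \<open>cmp_intros\<close> follow the syntax, so a function is shown computable by unfolding its
  definition.\<close>

definition cmp :: "('a::enc \<Rightarrow> 'b::enc) \<Rightarrow> bool" where
  "cmp f \<longleftrightarrow> (\<exists>c. computable c \<and> (\<forall>x. c (enc x) = enc (f x)))"

lemma cmpI: "computable c \<Longrightarrow> (\<And>x. c (enc x) = enc (f x)) \<Longrightarrow> cmp f"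
  by (auto simp: cmp_def)

lemma cmpE:
  assumes "cmp f" obtains c where "computable c" "\<And>x. c (enc x) = enc (f x)"
  using assms by (auto simp: cmp_def)

named_theorems cmp_intros

lemma cmp_id [cmp_intros]: "cmp (\<lambda>x. x)"
  by (rule cmpI[OF computable_id]) simp

lemma cmp_const [cmp_intros]: "cmp (\<lambda>x. k)"
  by (rule cmpI[OF computable_const]) simp

text \<open>With the identity for \<open>c\<close> this also handles changes of type that leave the
  code as it is, such as \<open>list_decode\<close> or \<open>enc\<close> itself.\<close>

lemma cmp_computable:
  assumes "computable c" "cmp f" "\<And>x. c (enc (f x)) = enc (g x)"
  shows "cmp g"
proof -
  obtain d where "computable d" "\<And>x. d (enc x) = enc (f x)"
    using assms(2) by (rule cmpE) (rule that)
  then show ?thesis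
    using assms by (intro cmpI[of "\<lambda>x. c (d x)"] computable_comp[OF assms(1)]) auto
qed

lemma cmp_computable_nat: "computable c \<Longrightarrow> cmp f \<Longrightarrow> cmp (\<lambda>x. c (f x))"
  by (rule cmp_computable[of c f]) auto

lemma cmp_comp:
  assumes "cmp f" "cmp g" shows "cmp (\<lambda>x. f (g x))"
proof -
  obtain c where c: "computable c" "\<And>x. c (enc x) = enc (f x)"
    using assms(1) by (rule cmpE) (rule that)
  from c(1) assms(2) c(2) show ?thesis
    by (rule cmp_computable)
qed

lemma cmp_Pair [cmp_intros]:
  assumes "cmp f" "cmp g" shows "cmp (\<lambda>x. (f x, g x))"
proof -
  obtain c where "computable c" "\<And>x. c (enc x) = enc (f x)"
    using assms(1) by (rule cmpE) (rule that)
  moreover obtain d where "computable d" "\<And>x. d (enc x) = enc (g x)"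
    using assms(2) by (rule cmpE) (rule that)
  ultimately show ?thesis
    by (intro cmpI[of "\<lambda>x. prod_encode (c x, d x)"] computable_prod_encode) auto
qed

lemma cmp_fst [cmp_intros]: "cmp f \<Longrightarrow> cmp (\<lambda>x. fst (f x))"
  by (erule cmp_computable[OF computable_fst_prod_decode[OF computable_id]]) (auto simp: enc_prod_def)

lemma cmp_snd [cmp_intros]: "cmp f \<Longrightarrow> cmp (\<lambda>x. snd (f x))"
  by (erule cmp_computable[OF computable_snd_prod_decode[OF computable_id]]) (auto simp: enc_prod_def)

lemma cmp_enc [cmp_intros]: "cmp f \<Longrightarrow> cmp (\<lambda>x. enc (f x))"
  by (erule cmp_computable[OF computable_id]) auto

lemma cmp_list_encode [cmp_intros]: "cmp f \<Longrightarrow> cmp (\<lambda>x. list_encode (f x))"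
  by (erule cmp_computable[OF computable_id]) (auto simp: enc_nat_list)

lemma cmp_list_decode [cmp_intros]: "cmp f \<Longrightarrow> cmp (\<lambda>x. list_decode (f x))"
  by (erule cmp_computable[OF computable_id]) (auto simp: enc_nat_list)

lemma cmp_prod_encode [cmp_intros]: "cmp f \<Longrightarrow> cmp (\<lambda>x. prod_encode (f x))"
  by (erule cmp_computable[OF computable_id]) (auto simp: enc_prod_def)

lemma cmp_prod_decode [cmp_intros]: "cmp f \<Longrightarrow> cmp (\<lambda>x. prod_decode (f x))"
  by (erule cmp_computable[OF computable_id]) (auto simp: enc_prod_def)

lemma cmp_Suc [cmp_intros]: "cmp f \<Longrightarrow> cmp (\<lambda>x. Suc (f x))"
  by (erule cmp_computable[OF computable_Suc[OF computable_id]]) auto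

lemma cmp_add [cmp_intros]: "cmp f \<Longrightarrow> cmp g \<Longrightarrow> cmp (\<lambda>x. f x + g x :: nat)"
  by (rule cmp_computable[where f = "\<lambda>x. (f x, g x)"
        and c = "\<lambda>z. fst (prod_decode z) + snd (prod_decode z)"])
    (auto intro!: cmp_intros computable_add computable_fst_prod_decode computable_snd_prod_decode computable_id)

lemma cmp_diff [cmp_intros]: "cmp f \<Longrightarrow> cmp g \<Longrightarrow> cmp (\<lambda>x. f x - g x :: nat)"
  by (rule cmp_computable[where f = "\<lambda>x. (f x, g x)"
        and c = "\<lambda>z. fst (prod_decode z) - snd (prod_decode z)"])
    (auto intro!: cmp_intros computable_diff computable_fst_prod_decode computable_snd_prod_decode computable_id)

lemma cmp_rec_nat [cmp_intros]:
  assumes "cmp f" "cmp (\<lambda>z. g (fst z) (fst (snd z)) (snd (snd z)))" "cmp n"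
  shows "cmp (\<lambda>x. rec_nat (f x) (g x) (n x))"
proof -
  obtain cf where cf: "computable cf" "\<And>x. cf (enc x) = enc (f x)"
    using assms(1) by (rule cmpE) (rule that)
  obtain cg where cg: "computable cg"
    "\<And>z. cg (enc z) = enc (g (fst z) (fst (snd z)) (snd (snd z)))"
    using assms(2) by (rule cmpE) (rule that)
  obtain cn where cn: "computable cn" "\<And>x. cn (enc x) = enc (n x)"
    using assms(3) by (rule cmpE) (rule that)
  have "rec_nat (cf (enc x)) (\<lambda>y r. cg (prod_encode (enc x, prod_encode (y, r)))) k
    = enc (rec_nat (f x) (g x) k)" for x k
  proof (induction k)
    case (Suc k)
    show ?case using Suc cg(2)[of "(x, k, rec_nat (f x) (g x) k)"] by simp
  qed (simp add: cf(2))
  then show ?thesis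
    by (intro cmpI[OF computable_rec_nat[OF cf(1) cg(1) cn(1)]]) (simp add: cn(2))
qed

lemma cmp_If [cmp_intros]:
  assumes "cmp b" "cmp f" "cmp g"
  shows "cmp (\<lambda>x. if b x then f x else g x)"
proof -
  \<comment> \<open>A Boolean has code 0 or 1, so recursion along it makes no step or one step,
    which is a case distinction.\<close>
  have "cmp (\<lambda>x. rec_nat (g x) (\<lambda>_ _. f x) (enc (b x)))"
    by (rule cmp_rec_nat[OF assms(3) cmp_comp[OF assms(2) cmp_fst[OF cmp_id]] cmp_enc[OF assms(1)]])
  also have "(\<lambda>x. rec_nat (g x) (\<lambda>_ _. f x) (enc (b x))) = (\<lambda>x. if b x then f x else g x)"
    by (auto simp: enc_bool_def)
  finally show ?thesis .
qed

lemma cmp_conj [cmp_intros]: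
  assumes "cmp f" "cmp g" shows "cmp (\<lambda>x. f x \<and> g x)"
proof -
  have "(\<lambda>x. f x \<and> g x) = (\<lambda>x. if f x then g x else False)"
    by auto
  then show ?thesis using cmp_If[OF assms cmp_const] by simp
qed

lemma cmp_disj [cmp_intros]:
  assumes "cmp f" "cmp g" shows "cmp (\<lambda>x. f x \<or> g x)"
proof -
  have "(\<lambda>x. f x \<or> g x) = (\<lambda>x. if f x then True else g x)"
    by auto
  then show ?thesis using cmp_If[OF assms(1) cmp_const assms(2)] by simp
qed

text \<open>The truncated differences in both directions sum to 0 exactly for equal numbers. Only
  numbers are compared: elsewhere \<open>enc\<close> may identify different values.\<close>

lemma cmp_nat_eq [cmp_intros]:
  fixes f g :: "'a::enc \<Rightarrow> nat"
  assumes "cmp f" "cmp g" shows "cmp (\<lambda>x. f x = g x)"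
  by (rule cmp_computable[where f = "\<lambda>x. 1 - ((f x - g x) + (g x - f x))", OF computable_id])
    (auto intro!: cmp_intros assms simp: enc_bool_def)

lemma cmp_Cons [cmp_intros]: "cmp f \<Longrightarrow> cmp g \<Longrightarrow> cmp (\<lambda>x. f x # g x)"
  by (rule cmp_computable[where f = "\<lambda>x. (f x, g x)", OF computable_Suc[OF computable_id]])
    (auto intro!: cmp_intros)

lemma cmp_case_list [cmp_intros]:
  assumes "cmp l" "cmp a" "cmp (\<lambda>z. b (fst z) (fst (snd z)) (snd (snd z)))"
  shows "cmp (\<lambda>x. case l x of [] \<Rightarrow> a x | y # ys \<Rightarrow> b x y ys)"
proof -
  obtain cl where cl: "computable cl" "\<And>x. cl (enc x) = enc (l x)"
    using assms(1) by (rule cmpE) (rule that)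
  obtain ca where ca: "computable ca" "\<And>x. ca (enc x) = enc (a x)"
    using assms(2) by (rule cmpE) (rule that)
  obtain cb where cb: "computable cb"
    "\<And>z. cb (enc z) = enc (b (fst z) (fst (snd z)) (snd (snd z)))"
    using assms(3) by (rule cmpE) (rule that)
  \<comment> \<open>A cons cell is coded as the successor of the pair of head and tail. Recursion
    along the code that drops the recursive value hands exactly this pair to
    \<open>cb\<close>.\<close>
  have "computable (\<lambda>z. cb (prod_encode (fst (prod_decode z), fst (prod_decode (snd (prod_decode z))))))"
    by (intro computable_comp[OF cb(1)] computable_prod_encode computable_fst_prod_decode
      computable_snd_prod_decode computable_id)
  from computable_rec_nat[OF ca(1) this cl(1)]
  have "computable (\<lambda>x. rec_nat (ca x) (\<lambda>k r. cb (prod_encode (x, k))) (cl x))"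
    by simp
  moreover have "rec_nat (ca (enc x)) (\<lambda>k r. cb (prod_encode (enc x, k))) (cl (enc x))
    = enc (case l x of [] \<Rightarrow> a x | y # ys \<Rightarrow> b x y ys)" for x
  proof (cases "l x")
    case (Cons y ys)
    then show ?thesis using cb(2)[of "(x, y, ys)"] by (simp add: cl(2))
  qed (simp add: cl ca)
  ultimately show ?thesis by (rule cmpI)
qed

text \<open>The state is constant once the list is used up, so any bound on the length may count the
  rounds. The code of the list is such a bound; the length is itself shown computable by a
  fold.\<close>

lemma foldl_conv_rec_nat:
  assumes "length l \<le> n"
  shows "foldl f a l = fst (rec_nat (a, l)
    (\<lambda>k s. case snd s of [] \<Rightarrow> s | y # ys \<Rightarrow> (f (fst s) y, ys)) n)"
proof -
  have "rec_nat (a, l) (\<lambda>k s. case snd s of [] \<Rightarrow> s | y # ys \<Rightarrow> (f (fst s) y, ys)) n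
      = (foldl f a (take n l), drop n l)" for n
  proof (induction n)
    case (Suc n)
    show ?case
    proof (cases "drop n l")
      case (Cons y ys)
      have "n < length l"
        using Cons by (rule contrapos_pp) simp
      moreover have "l ! n = y" "drop (Suc n) l = ys"
        using Cons by (auto simp: nth_via_drop drop_Suc tl_drop[symmetric])
      ultimately show ?thesis using Suc Cons by (simp add: take_Suc_conv_app_nth)
    qed (use Suc in auto)
  qed simp
  then show ?thesis using assms by simp
qed

lemma length_le_enc: "length l \<le> enc l"
proof (induction l)
  case (Cons x l)
  then show ?case using le_prod_encode_2[of "enc l" "enc x"] by simp
qed simp

lemma cmp_foldl [cmp_intros]:
  assumes "cmp (\<lambda>z. f (fst z) (fst (snd z)) (snd (snd z)))" "cmp a" "cmp l"
  shows "cmp (\<lambda>x. foldl (f x) (a x) (l x))"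
  unfolding foldl_conv_rec_nat[OF length_le_enc]
  by (intro cmp_intros assms cmp_comp[OF assms(1),
    of "\<lambda>z. (fst (fst z), fst (snd (snd (fst z))), fst (snd z))", simplified])

lemma cmp_rev [cmp_intros]: "cmp l \<Longrightarrow> cmp (\<lambda>x. rev (l x))"
proof -
  have "rev ys = foldl (\<lambda>r y. y # r) [] ys" for ys :: "'b list"
    by (induction ys rule: rev_induct) auto
  then show "cmp l \<Longrightarrow> cmp (\<lambda>x. rev (l x))"
    by (simp only:) (intro cmp_intros)
qed

lemma cmp_foldr [cmp_intros]:
  assumes "cmp (\<lambda>z. f (fst z) (fst (snd z)) (snd (snd z)))" "cmp a" "cmp l"
  shows "cmp (\<lambda>x. foldr (f x) (l x) (a x))"
  unfolding foldr_conv_foldl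
  by (intro cmp_intros assms cmp_comp[OF assms(1),
    of "\<lambda>z. (fst z, snd (snd z), fst (snd z))", simplified])

lemma cmp_map [cmp_intros]:
  fixes f :: "'a::enc \<Rightarrow> 'b::enc \<Rightarrow> 'c::enc"
  assumes "cmp (\<lambda>z. f (fst z) (snd z))" "cmp l"
  shows "cmp (\<lambda>x. map (f x) (l x))"
proof -
  have eq: "map g ys = foldr (\<lambda>y r. g y # r) ys []" for g :: "'b \<Rightarrow> 'c" and ys
    by (induction ys) auto
  show ?thesis
    unfolding eq by (intro cmp_intros assms cmp_comp[OF assms(1),
      of "\<lambda>z. (fst z, fst (snd z))", simplified])
qed

lemma cmp_append [cmp_intros]: "cmp f \<Longrightarrow> cmp g \<Longrightarrow> cmp (\<lambda>x. f x @ g x)"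
proof -
  have "ys @ zs = foldr (\<lambda>y r. y # r) ys zs" for ys zs :: "'b list"
    by (induction ys) auto
  then show "cmp f \<Longrightarrow> cmp g \<Longrightarrow> cmp (\<lambda>x. f x @ g x)"
    by (simp only:) (intro cmp_intros)
qed

lemma cmp_filter [cmp_intros]:
  fixes f :: "'a::enc \<Rightarrow> 'b::enc \<Rightarrow> bool"
  assumes "cmp (\<lambda>z. f (fst z) (snd z))" "cmp l"
  shows "cmp (\<lambda>x. filter (f x) (l x))"
proof -
  have eq: "filter g ys = foldr (\<lambda>y r. if g y then y # r else r) ys []" for g :: "'b \<Rightarrow> bool" and ys
    by (induction ys) auto
  show ?thesis
    unfolding eq by (intro cmp_intros assms cmp_comp[OF assms(1),
      of "\<lambda>z. (fst z, fst (snd z))", simplified])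
qed

lemma cmp_list_all [cmp_intros]:
  fixes f :: "'a::enc \<Rightarrow> 'b::enc \<Rightarrow> bool"
  assumes "cmp (\<lambda>z. f (fst z) (snd z))" "cmp l"
  shows "cmp (\<lambda>x. list_all (f x) (l x))"
proof -
  have eq: "list_all g ys = foldr (\<lambda>y r. g y \<and> r) ys True" for g :: "'b \<Rightarrow> bool" and ys
    by (induction ys) auto
  show ?thesis
    unfolding eq by (intro cmp_intros assms cmp_comp[OF assms(1),
      of "\<lambda>z. (fst z, fst (snd z))", simplified])
qed

lemma cmp_list_ex [cmp_intros]:
  fixes f :: "'a::enc \<Rightarrow> 'b::enc \<Rightarrow> bool"
  assumes "cmp (\<lambda>z. f (fst z) (snd z))" "cmp l"
  shows "cmp (\<lambda>x. list_ex (f x) (l x))"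
proof -
  have eq: "list_ex g ys = foldr (\<lambda>y r. g y \<or> r) ys False" for g :: "'b \<Rightarrow> bool" and ys
    by (induction ys) auto
  show ?thesis
    unfolding eq by (intro cmp_intros assms cmp_comp[OF assms(1),
      of "\<lambda>z. (fst z, fst (snd z))", simplified])
qed

lemma cmp_length [cmp_intros]: "cmp l \<Longrightarrow> cmp (\<lambda>x. length (l x))"
proof -
  have "length ys = foldr (\<lambda>y r. Suc r) ys 0" for ys :: "'b list"
    by (induction ys) auto
  then show "cmp l \<Longrightarrow> cmp (\<lambda>x. length (l x))"
    by (simp only:) (intro cmp_intros)
qed

lemma cmp_nat_mem [cmp_intros]:
  fixes f :: "'a::enc \<Rightarrow> nat"
  assumes "cmp f" "cmp l" shows "cmp (\<lambda>x. f x \<in> set (l x))"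
proof -
  have "y \<in> set ys \<longleftrightarrow> list_ex (\<lambda>z. y = z) ys" for y :: nat and ys
    by (auto simp: list_ex_iff)
  then show ?thesis
    by (simp only:) (intro cmp_intros assms cmp_comp[OF assms(1)])
qed

lemma cmp_list_all2 [cmp_intros]:
  fixes f :: "'a::enc \<Rightarrow> 'b::enc \<Rightarrow> 'c::enc \<Rightarrow> bool"
  assumes "cmp (\<lambda>z. f (fst z) (fst (snd z)) (snd (snd z)))" "cmp k" "cmp l"
  shows "cmp (\<lambda>x. list_all2 (f x) (k x) (l x))"
proof -
  \<comment> \<open>The state holds the verdict so far and the unread rest of the second list. If
    that list ends too early, the verdict is false for good; the final test rejects a nonempty
    rest.\<close>
  let ?step = "\<lambda>g s y. case snd s of [] \<Rightarrow> (False, []) | z # zs \<Rightarrow> (g y z \<and> fst s, zs)"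
  have False: "\<not> fst (foldl (?step g) (False, zs) ys)"
    for g :: "'b \<Rightarrow> 'c \<Rightarrow> bool" and ys zs
    by (induction ys arbitrary: zs) (auto split: list.split)
  have eq: "list_all2 g ys zs = (fst (foldl (?step g) (True, zs) ys) \<and>
    (case snd (foldl (?step g) (True, zs) ys) of [] \<Rightarrow> True | _ # _ \<Rightarrow> False))"
    for g :: "'b \<Rightarrow> 'c \<Rightarrow> bool" and ys zs
  proof (induction ys arbitrary: zs)
    case (Cons y ys)
    show ?case
      by (cases zs; cases "g y (hd zs)") (auto simp: Cons False)
  qed (auto split: list.split)
  show ?thesis
    unfolding eq
    by (intro cmp_intros assms cmp_comp[OF assms(1),
      of "\<lambda>z. (fst (fst z), snd (snd (fst z)), fst (snd z))", simplified])
qed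

lemma cmp_mod_2 [cmp_intros]: "cmp f \<Longrightarrow> cmp (\<lambda>x. f x mod 2 :: nat)"
proof -
  have "n mod 2 = rec_nat 0 (\<lambda>k r. 1 - r) n" for n :: nat
    by (induction n) (auto simp: mod_Suc)
  then show "cmp f \<Longrightarrow> cmp (\<lambda>x. f x mod 2 :: nat)"
    by (simp only:) (intro cmp_intros)
qed

lemma cmp_div_2 [cmp_intros]: "cmp f \<Longrightarrow> cmp (\<lambda>x. f x div 2 :: nat)"
proof -
  have "n div 2 = rec_nat 0 (\<lambda>k r. r + k mod 2) n" for n :: nat
    by (induction n) (auto, presburger)
  then show "cmp f \<Longrightarrow> cmp (\<lambda>x. f x div 2 :: nat)"
    by (simp only:) (intro cmp_intros)
qed

text \<open>Course-of-values recursion: the code of a subterm is smaller than the code of the term, so its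
  value can be looked up in the table of the values at all smaller codes.\<close>

definition lookup :: "(nat \<times> nat) list \<Rightarrow> nat \<Rightarrow> nat" where
  "lookup tab c = foldr (\<lambda>p r. if fst p = c then snd p else r) tab 0"

text \<open>\<open>k\<close> is read as the code of a term, even for a variable and odd for an
  application; \<open>e\<close> is the code of the parameter.\<close>

definition tfold_code :: "(nat \<Rightarrow> nat) \<Rightarrow> (nat \<Rightarrow> nat) \<Rightarrow> nat \<Rightarrow> (nat \<times> nat) list \<Rightarrow> nat \<Rightarrow> nat" where
  "tfold_code cF cG e tab k = (if k mod 2 = 0 then cF (prod_encode (e, k div 2))
     else cG (prod_encode (e, prod_encode (fst (prod_decode (k div 2)),
       list_encode (map (lookup tab) (list_decode (snd (prod_decode (k div 2)))))))))"

definition tfold_table :: "(nat \<Rightarrow> nat) \<Rightarrow> (nat \<Rightarrow> nat) \<Rightarrow> nat \<Rightarrow> nat \<Rightarrow> (nat \<times> nat) list" where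
  "tfold_table cF cG e n = rec_nat [] (\<lambda>k tab. (k, tfold_code cF cG e tab k) # tab) n"

lemma lookup_tfold_table:
  "k < n \<Longrightarrow> lookup (tfold_table cF cG e n) k = tfold_code cF cG e (tfold_table cF cG e k) k"
  by (induction n) (auto simp: tfold_table_def lookup_def less_Suc_eq)

lemma cmp_tfold [cmp_intros]:
  assumes "cmp (\<lambda>z. F (fst z) (snd z))" "cmp (\<lambda>z. G (fst z) (fst (snd z)) (snd (snd z)))" "cmp t"
  shows "cmp (\<lambda>x. tfold (F x) (G x) (t x))"
proof -
  obtain cF where cF: "computable cF" "\<And>z. cF (enc z) = enc (F (fst z) (snd z))"
    using assms(1) by (rule cmpE) (rule that)
  obtain cG where cG: "computable cG"
    "\<And>z. cG (enc z) = enc (G (fst z) (fst (snd z)) (snd (snd z)))"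
    using assms(2) by (rule cmpE) (rule that)
  let ?tab = "tfold_table cF cG"
  \<comment> \<open>All \<open>n\<close> above the code are needed: the arguments are looked up in
    the shorter table that existed when the entry of the whole term was made.\<close>
  have lookup: "lookup (?tab (enc x) n) (enc t) = enc (tfold (F x) (G x) t)" if "enc t < n" for x t n
    using that
  proof (induction t arbitrary: n)
    case (Var v)
    then show ?case
      using cF(2)[of "(x, v)"] by (simp add: lookup_tfold_table tfold_code_def enc_Var)
  next
    case (Fun f ts)
    have args: "map (lookup (?tab (enc x) (enc (Fun f ts)))) (map enc ts)
        = map enc (map (tfold (F x) (G x)) ts)"
      by (auto intro!: Fun.IH enc_arg_less)
    have div_2: "enc (Fun f ts) div 2 = prod_encode (enc f, enc ts)"
      and mod_2: "enc (Fun f ts) mod 2 = 1"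
      by (simp_all add: enc_Fun)
    have "lookup (?tab (enc x) n) (enc (Fun f ts)) = tfold_code cF cG (enc x)
        (?tab (enc x) (enc (Fun f ts))) (enc (Fun f ts))"
      using Fun.prems by (rule lookup_tfold_table)
    also have "\<dots> = cG (prod_encode (enc x, prod_encode (enc f, list_encode
        (map (lookup (?tab (enc x) (enc (Fun f ts)))) (map enc ts)))))"
      unfolding tfold_code_def div_2 mod_2 by (simp add: enc_list_def)
    also have "\<dots> = enc (tfold (F x) (G x) (Fun f ts))"
      unfolding args using cG(2)[of "(x, f, map (tfold (F x) (G x)) ts)"]
      by (simp add: enc_list_def)
    finally show ?case .
  qed
  have "cmp (\<lambda>z. lookup (?tab (fst z) (Suc (snd z))) (snd z))"
    unfolding lookup_def tfold_table_def tfold_code_def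
    by (intro cmp_intros cmp_computable_nat[OF cF(1)] cmp_computable_nat[OF cG(1)])
  then have "cmp (\<lambda>x. lookup (?tab (enc x) (Suc (enc (t x)))) (enc (t x)))"
    using cmp_comp[of _ "\<lambda>x. (enc x, enc (t x))"] by (force intro: cmp_intros assms)
  then show ?thesis
    by (rule cmp_computable[OF computable_id]) (simp add: lookup)
qed

section \<open>Lifting derivations between instances\<close>

lemma subst_subst: "subst \<sigma> (subst \<rho> t) = subst (\<lambda>x. subst \<sigma> (\<rho> x)) t"
  by (induction t) auto

lemma subst_cong: "(\<And>x. x \<in> vars t \<Longrightarrow> \<sigma> x = \<rho> x) \<Longrightarrow> subst \<sigma> t = subst \<rho> t"
  by (induction t) auto

lemma subst_eqD: "subst \<sigma> t = subst \<rho> t \<Longrightarrow> x \<in> vars t \<Longrightarrow> \<sigma> x = \<rho> x"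
  by (induction t) auto

lemma rstep_subst: "(s, t) \<in> rstep R \<Longrightarrow> (subst \<sigma> s, subst \<sigma> t) \<in> rstep R"
proof (induction rule: rstep.induct)
  case (root l r \<rho>)
  then show ?case unfolding subst_subst by (rule rstep.root)
qed (auto intro: rstep.arg)

lemma rsteps_subst: "(s, t) \<in> (rstep R)\<^sup>* \<Longrightarrow> (subst \<sigma> s, subst \<sigma> t) \<in> (rstep R)\<^sup>*"
  by (induction rule: rtrancl_induct) (auto intro: rstep_subst rtrancl_into_rtrancl)

lemma rsteps_arg:
  "(s, t) \<in> (rstep R)\<^sup>* \<Longrightarrow> (Fun f (us @ s # vs), Fun f (us @ t # vs)) \<in> (rstep R)\<^sup>*"
  by (induction rule: rtrancl_induct) (auto intro: rstep.arg rtrancl_into_rtrancl)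

text \<open>The prefix \<open>us\<close> collects the arguments already rewritten, which makes the
  induction go through.\<close>

lemma rsteps_args:
  "list_all2 (\<lambda>s t. (s, t) \<in> (rstep R)\<^sup>*) ss ts \<Longrightarrow>
    (Fun f (us @ ss), Fun f (us @ ts)) \<in> (rstep R)\<^sup>*"
proof (induction arbitrary: us rule: list_all2_induct)
  case (Cons s ss t ts)
  have "(Fun f (us @ s # ss), Fun f (us @ t # ss)) \<in> (rstep R)\<^sup>*"
    using Cons.hyps(1) by (rule rsteps_arg)
  also have "(Fun f (us @ t # ss), Fun f (us @ t # ts)) \<in> (rstep R)\<^sup>*"
    using Cons.IH[of "us @ [t]"] by simp
  finally show ?case .
qed simp

lemma rstep_subset_rsteps:
  assumes "S \<subseteq> (rstep R)\<^sup>*" shows "rstep S \<subseteq> (rstep R)\<^sup>*"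
proof (rule subrelI)
  fix s t assume "(s, t) \<in> rstep S"
  then show "(s, t) \<in> (rstep R)\<^sup>*"
  proof (induction rule: rstep.induct)
    case (root l r \<sigma>)
    then show ?case using assms by (intro rsteps_subst) blast
  next
    case (arg s t f us vs)
    from arg.IH show ?case by (rule rsteps_arg)
  qed
qed

section \<open>Nesting depth of a set of symbols\<close>

primrec nesting :: "'f ranked set \<Rightarrow> ('f, 'v) trm \<Rightarrow> nat" where
  "nesting C (Var x) = 0"
| "nesting C (Fun f ts) =
    (if (f, length ts) \<in> C then 1 else 0) + Max (insert 0 (set (map (nesting C) ts)))"

lemma nesting_arg:
  assumes "t \<in> set ts"
  shows "(if (f, length ts) \<in> C then 1 else 0) + nesting C t \<le> nesting C (Fun f ts)"
proof -
  have "nesting C t \<le> Max (insert 0 (set (map (nesting C) ts)))"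
    using assms by (intro Max_ge) auto
  then show ?thesis by simp
qed

lemma nesting_arg_le: "t \<in> set ts \<Longrightarrow> nesting C t \<le> nesting C (Fun f ts)"
  by (rule add_leD2[OF nesting_arg])

lemma nesting_Fun_le:
  assumes "(f, length ts) \<notin> C" "\<And>t. t \<in> set ts \<Longrightarrow> nesting C t \<le> n"
  shows "nesting C (Fun f ts) \<le> n"
  using assms by auto

lemma nesting_subst_le:
  assumes "symbols t \<inter> C = {}" "\<And>x. x \<in> vars t \<Longrightarrow> nesting C (\<sigma> x) \<le> n"
  shows "nesting C (subst \<sigma> t) \<le> n"
  using assms
proof (induction t)
  case (Fun f ts)
  show ?case
    unfolding subst.simps
  proof (rule nesting_Fun_le)
    fix u assume "u \<in> set (map (subst \<sigma>) ts)"
    then obtain t where t: "t \<in> set ts" "u = subst \<sigma> t" by auto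
    then have "symbols t \<inter> C = {}" using Fun.prems(1) by auto
    then show "nesting C u \<le> n" using Fun t by auto
  qed (use Fun.prems(1) in auto)
qed simp

lemma nesting_subst_ge: "x \<in> vars t \<Longrightarrow> nesting C (\<sigma> x) \<le> nesting C (subst \<sigma> t)"
proof (induction t)
  case (Fun f ts)
  then obtain t where t: "t \<in> set ts" "nesting C (\<sigma> x) \<le> nesting C (subst \<sigma> t)" by auto
  then have "nesting C (subst \<sigma> t) \<le> nesting C (Fun f (map (subst \<sigma>) ts))"
    by (intro nesting_arg_le) simp
  with t(2) show ?case by simp
qed simp

text \<open>As \<open>r\<close> has no symbol of \<open>C\<close>, only the images of its variables
  contribute, and these also occur in the instance of \<open>l\<close>. Counting along a branch, not
  in the whole term, is what survives rules that duplicate variables.\<close>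

lemma nesting_rstep:
  assumes "C \<inter> sign R = {}" "\<And>l r. (l, r) \<in> R \<Longrightarrow> vars r \<subseteq> vars l"
  shows "(s, t) \<in> rstep R \<Longrightarrow> nesting C t \<le> nesting C s"
proof (induction rule: rstep.induct)
  case (root l r \<rho>)
  have "symbols r \<inter> C = {}" using root assms(1) by (auto simp: sign_def)
  then show ?case
    using assms(2)[OF root] by (intro nesting_subst_le nesting_subst_ge) auto
next
  case (arg s t f us vs)
  have "Max (insert 0 (set (map (nesting C) (us @ t # vs)))) \<le> Max (insert 0 (set (map (nesting C) (us @ s # vs))))"
  proof (rule Max.boundedI)
    fix k assume "k \<in> insert 0 (set (map (nesting C) (us @ t # vs)))"
    then consider "k = nesting C t" | "k \<in> insert 0 (set (map (nesting C) (us @ s # vs)))"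
      by auto
    then show "k \<le> Max (insert 0 (set (map (nesting C) (us @ s # vs))))"
    proof cases
      case 1
      have "nesting C s \<le> Max (insert 0 (set (map (nesting C) (us @ s # vs))))"
        by (intro Max_ge) auto
      from order_trans[OF arg.IH this] show ?thesis unfolding 1 .
    qed (intro Max_ge, auto)
  qed auto
  then show ?case by simp
qed

text \<open>The terms \<open>\<sigma> x\<close> are opaque to \<open>R\<close>. Being irreducible,
  they contain no redex; headed by a symbol of \<open>C\<close>, they cannot meet a function symbol
  of a left side; and by injectivity equal instances come from equal terms, as nonlinear left sides
  require. \<open>nesting_rstep\<close> keeps the lifted terms where injectivity holds.\<close>

lemma rsteps_of_subst:
  assumes disj: "C \<inter> sign R = {}" and vars: "\<And>l r. (l, r) \<in> R \<Longrightarrow> vars r \<subseteq> vars l"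
    and top: "\<And>x. \<exists>f ts. \<sigma> x = Fun f ts \<and> (f, length ts) \<in> C"
    and irr: "\<And>x. irreducible R (\<sigma> x)"
    and inj: "inj_on (subst \<sigma>) {u. nesting C u < N}"
    and le: "nesting C s < N" "nesting C t < N"
    and steps: "(subst \<sigma> s, subst \<sigma> t) \<in> (rstep R)\<^sup>*"
  shows "(s, t) \<in> (rstep R)\<^sup>*"
proof -
  \<comment> \<open>Below a variable \<open>x\<close> of \<open>l\<close>, the term
    \<open>\<rho> x\<close> is the instance of a subterm of \<open>u\<close>. Injectivity recovers
    that subterm from \<open>\<rho> x\<close> alone, whatever the position.\<close>
  have match: "u = subst (\<lambda>x. inv_into {u. nesting C u < N} (subst \<sigma>) (\<rho> x)) l"
    if "symbols l \<inter> C = {}" "subst \<sigma> u = subst \<rho> l" "nesting C u < N" for l \<rho> u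
    using that
  proof (induction l arbitrary: u)
    case (Var x)
    then show ?case using inv_into_f_f[OF inj, of u] by simp
  next
    case (Fun f ls)
    obtain us where us: "u = Fun f us" "map (subst \<sigma>) us = map (subst \<rho>) ls"
    proof (cases u)
      case (Var y)
      \<comment> \<open>A variable here would put a symbol of \<open>C\<close> at the root, where
        \<open>l\<close> has a symbol outside \<open>C\<close>.\<close>
      then show ?thesis using top[of y] Fun.prems by auto
    qed (use Fun.prems that in auto)
    then have len: "length us = length ls" by (metis length_map)
    have "us ! i = subst (\<lambda>x. inv_into {u. nesting C u < N} (subst \<sigma>) (\<rho> x)) (ls ! i)"
      if "i < length ls" for i
    proof (rule Fun.IH)
      show "ls ! i \<in> set ls" using that by simp
      then show "symbols (ls ! i) \<inter> C = {}" using Fun.prems(1) by auto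
      show "subst \<sigma> (us ! i) = subst \<rho> (ls ! i)"
        using us(2) that len by (metis nth_map)
      show "nesting C (us ! i) < N"
        using nesting_arg_le[of "us ! i" us C f] Fun.prems(3) us(1) that len by simp
    qed
    then show ?case using us(1) len by (auto intro: nth_equalityI)
  qed
  have lift: "\<exists>v. t = subst \<sigma> v \<and> (u, v) \<in> rstep R"
    if "(s, t) \<in> rstep R" "s = subst \<sigma> u" "nesting C u < N" for s t u
    using that
  proof (induction arbitrary: u rule: rstep.induct)
    case (root l r \<rho>)
    define \<rho>' where "\<rho>' x = inv_into {u. nesting C u < N} (subst \<sigma>) (\<rho> x)" for x
    have "symbols l \<inter> C = {}" using root disj by (auto simp: sign_def)
    then have u: "u = subst \<rho>' l"
      unfolding \<rho>'_def using root by (intro match) auto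
    \<comment> \<open>The pulled back substitution agrees with \<open>\<rho>\<close> on the
      variables of \<open>l\<close> only; those of \<open>r\<close> are among them.\<close>
    then have "subst (\<lambda>x. subst \<sigma> (\<rho>' x)) l = subst \<rho> l"
      using root by (simp add: subst_subst)
    from subst_eqD[OF this] have "subst \<sigma> (subst \<rho>' r) = subst \<rho> r"
      unfolding subst_subst using vars[OF root(1)] by (intro subst_cong) blast
    then show ?case
      using u rstep.root[OF root(1)] by metis
  next
    case (arg s t f us vs)
    show ?case
    proof (cases u)
      case (Var x)
      then have "\<sigma> x = Fun f (us @ s # vs)" using arg.prems by simp
      then have False
        using irr[of x] rstep.arg[OF arg.hyps] by (auto simp: irreducible_def)
      then show ?thesis ..
    next
      case (Fun g ws)
      then have f: "f = g" and "map (subst \<sigma>) ws = us @ s # vs"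
        using arg.prems(1) by auto
      then obtain us' w vs' where ws: "ws = us' @ w # vs'" "map (subst \<sigma>) us' = us"
        "subst \<sigma> w = s" "map (subst \<sigma>) vs' = vs"
        by (auto simp: map_eq_append_conv map_eq_Cons_conv)
      have "nesting C w < N"
        using nesting_arg_le[of w ws C g] arg.prems(2) Fun ws(1) by simp
      with arg.IH ws(3) obtain v where "t = subst \<sigma> v" "(w, v) \<in> rstep R" by blast
      then show ?thesis
        using Fun f ws by (intro exI[of _ "Fun g (us' @ v # vs')"]) (auto intro: rstep.arg)
    qed
  qed
  have "\<exists>v. subst \<sigma> t = subst \<sigma> v \<and> nesting C v < N \<and> (s, v) \<in> (rstep R)\<^sup>*"
    using steps
  proof (induction rule: rtrancl_induct)
    case base
    then show ?case using le(1) by blast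
  next
    case (step y z)
    then obtain v where v: "y = subst \<sigma> v" "nesting C v < N" "(s, v) \<in> (rstep R)\<^sup>*" by blast
    with lift[OF step(2)] obtain w where w: "z = subst \<sigma> w" "(v, w) \<in> rstep R" by blast
    then have "nesting C w < N"
      using nesting_rstep[OF disj vars, of v w] v(2) by simp
    with v w show ?case by (blast intro: rtrancl_into_rtrancl)
  qed
  with inj le(2) show ?thesis by (auto dest: inj_onD)
qed

lemma irreducible_Fun:
  assumes no_var: "\<And>x r. (Var x, r) \<notin> R" and "(f, length ts) \<notin> sign R"
    and args: "\<And>t. t \<in> set ts \<Longrightarrow> irreducible R t"
  shows "irreducible R (Fun f ts)"
  unfolding irreducible_def
proof
  assume "\<exists>u. (Fun f ts, u) \<in> rstep R"
  then obtain u where "(Fun f ts, u) \<in> rstep R" ..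
  then show False
  proof (cases rule: rstep.cases)
    case (root l r \<rho>)
    then show False
      using no_var assms(2) by (cases l) (force simp: sign_def)+
  next
    case (arg s t us vs)
    then show False using args by (auto simp: irreducible_def)
  qed
qed

text \<open>A rule with a variable as left side rewrites every term. One irreducible term excludes
  such rules, on which the irreducibility of both the trees and the fresh constants rests.\<close>

lemma irreducible_imp_no_Var: "irreducible R t \<Longrightarrow> (Var x, r) \<notin> R"
  using rstep.root[of "Var x" r R "\<lambda>_. t"] by (auto simp: irreducible_def)

text \<open>Two terms are compared from the root. Function symbols must agree and pass the
  comparison on to the arguments, so a confusion can only start where one side is a
  variable.\<close>

lemma inj_on_substI:
  assumes var: "\<And>v x. nesting C v < N \<Longrightarrow> subst \<sigma> v = \<sigma> x \<Longrightarrow> v = Var x"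
  shows "inj_on (subst \<sigma>) {u. nesting C u < N}"
proof (rule inj_onI, unfold mem_Collect_eq)
  fix u v assume "nesting C u < N" "nesting C v < N" "subst \<sigma> u = subst \<sigma> v"
  then show "u = v"
  proof (induction u arbitrary: v)
    case (Var x)
    then show ?case using var[of v x] by simp
  next
    case (Fun f us)
    show ?case
    proof (cases v)
      case (Var y)
      then show ?thesis using var[of "Fun f us" y] Fun.prems by simp
    next
      case v: (Fun h vs)
      then have eq: "f = h" "map (subst \<sigma>) us = map (subst \<sigma>) vs"
        using Fun.prems(3) by auto
      then have len: "length us = length vs" by (metis length_map)
      have "us ! i = vs ! i" if "i < length us" for i
      proof (rule Fun.IH)
        show mem: "us ! i \<in> set us" using that by simp
        have mem': "vs ! i \<in> set vs" using that len by simp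
        show "nesting C (us ! i) < N"
          using nesting_arg_le[OF mem, of "C" f] Fun.prems(1) by linarith
        show "nesting C (vs ! i) < N"
          using nesting_arg_le[OF mem', of "C" h] Fun.prems(2) v by simp
        show "subst \<sigma> (us ! i) = subst \<sigma> (vs ! i)"
          using eq(2) that len by (metis nth_map)
      qed
      then show ?thesis using v eq(1) len by (auto intro: nth_equalityI)
    qed
  qed
qed

section \<open>Ground trees in place of variables\<close>

definition full_tree :: "'f \<Rightarrow> nat \<Rightarrow> 'f \<Rightarrow> nat \<Rightarrow> ('f, 'v) trm" where
  "full_tree g n a k = ((\<lambda>t. Fun g (replicate n t)) ^^ k) (Fun a [])"

lemma full_tree_simps [simp]:
  "full_tree g n a 0 = Fun a []"
  "full_tree g n a (Suc k) = Fun g (replicate n (full_tree g n a k))"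
  by (simp_all add: full_tree_def)

lemma nesting_full_tree: "0 < n \<Longrightarrow> nesting {(g, n)} (full_tree g n a k) = k"
  by (induction k) auto

lemma full_tree_eq_iff:
  "0 < n \<Longrightarrow> full_tree g n a k = (full_tree g n a m :: ('f, 'v) trm) \<longleftrightarrow> k = m"
  using nesting_full_tree[of n g a k, where 'b = 'v] nesting_full_tree[of n g a m, where 'b = 'v]
  by metis

text \<open>All branches of a full tree have the same height, so following first arguments in
  \<open>v\<close> is enough. This path either passes \<open>m\<close> symbols \<open>g\<close>
  inside \<open>v\<close> or meets a variable \<open>y\<close> after \<open>k\<close> of them, and
  \<open>\<sigma> y\<close> supplies the remaining height.\<close>

lemma subst_eq_full_tree:
  fixes \<sigma> :: "nat \<Rightarrow> ('f, 'v) trm"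
  assumes "0 < n" "\<And>x. \<sigma> x = full_tree g n a (N * Suc x)"
    and "subst \<sigma> v = full_tree g n a m"
  shows "(\<exists>y. v = Var y \<and> m = N * Suc y) \<or> m \<le> nesting {(g, n)} v \<or>
    (\<exists>k y. 0 < k \<and> k \<le> nesting {(g, n)} v \<and> m = k + N * Suc y)"
  using assms(3)
proof (induction v arbitrary: m)
  case (Var x)
  then show ?case using assms(1,2) by (simp add: full_tree_eq_iff)
next
  case (Fun f vs)
  show ?case
  proof (cases m)
    case (Suc m')
    with Fun.prems have vs: "f = g" "map (subst \<sigma>) vs = replicate n (full_tree g n a m')"
      by auto
    then have len: "length vs = n" by (metis length_map length_replicate)
    with assms(1) have v: "vs ! 0 \<in> set vs" by simp
    have "subst \<sigma> (vs ! 0) = full_tree g n a m'"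
      using vs(2) len assms(1) by (metis nth_map nth_replicate)
    note IH = Fun.IH[OF v this]
    have le: "Suc (nesting {(g, n)} (vs ! 0)) \<le> nesting {(g, n)} (Fun f vs)"
      using nesting_arg[OF v, of g "{(g, n)}"] vs(1) len by simp
    from IH show ?thesis
    proof (elim disjE exE conjE)
      fix y assume "m' = N * Suc y"
      then show ?thesis using Suc le by (intro disjI2 exI[of _ 1] exI[of _ y]) simp
    next
      assume "m' \<le> nesting {(g, n)} (vs ! 0)"
      then show ?thesis using Suc le by simp
    next
      fix k y assume "k \<le> nesting {(g, n)} (vs ! 0)" "m' = k + N * Suc y"
      then show ?thesis using Suc le by (intro disjI2 exI[of _ "Suc k"] exI[of _ y]) simp
    qed
  qed simp
qed

text \<open>The heights of the trees are distinct multiples of \<open>N\<close>, so a term with fewer than \<open>N\<close>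
  nested occurrences of \<open>g\<close> cannot turn the tree of one variable into that of another.\<close>

lemma inj_on_subst_full_tree:
  fixes \<sigma> :: "nat \<Rightarrow> ('f, 'v) trm"
  assumes "0 < n" "\<And>x. \<sigma> x = full_tree g n a (N * Suc x)"
  shows "inj_on (subst \<sigma>) {u. nesting {(g, n)} u < N}"
proof (rule inj_on_substI)
  show "v = Var x" if "nesting {(g, n)} v < N" "subst \<sigma> v = \<sigma> x" for v x
  proof -
    have "N \<noteq> 0" using that(1) by simp
    have "subst \<sigma> v = full_tree g n a (N * Suc x)" using that(2) assms(2) by simp
    from subst_eq_full_tree[OF assms this] show ?thesis
    proof (elim disjE exE conjE)
      fix y assume "v = Var y" "N * Suc x = N * Suc y"
      then show ?thesis using \<open>N \<noteq> 0\<close> by simp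
    next
      \<comment> \<open>The factor \<open>Suc x\<close> makes even the lowest tree taller than
        anything \<open>v\<close> can build by itself.\<close>
      assume "N * Suc x \<le> nesting {(g, n)} v"
      then show ?thesis using that(1) by simp
    next
      fix k y assume k: "0 < k" "k \<le> nesting {(g, n)} v" "N * Suc x = k + N * Suc y"
      \<comment> \<open>Both heights are multiples of \<open>N\<close>, hence so is
        \<open>k\<close>, although it lies strictly between 0 and \<open>N\<close>.\<close>
      then have "k mod N = 0" by (metis mod_mult_self2 mod_mult_self1_is_0)
      then show ?thesis using k that(1) by simp
    qed
  qed
qed

section \<open>Running tree automata\<close>

text \<open>A big-step form of the derivations, fit for bottom-up evaluation. The rule
  \<open>state\<close> is there because intermediate terms of a derivation mix symbols and
  states.\<close>

inductive reaches :: "('f, 'q) bta \<Rightarrow> ('f + 'q, 'v) trm \<Rightarrow> 'q \<Rightarrow> bool" for A where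
  state: "reaches A (Fun (Inr q) []) q"
| trans: "((f, qs), q) \<in> set (transitions A) \<Longrightarrow> list_all2 (reaches A) ts qs \<Longrightarrow>
    reaches A (Fun (Inl f) ts) q"
| eps: "reaches A t q \<Longrightarrow> (q, q') \<in> set (epsilons A) \<Longrightarrow> reaches A t q'"

lemma subst_state_trm [simp]: "subst \<sigma> (state_trm q) = state_trm q"
  by (simp add: state_trm_def)

lemma rsteps_of_reaches:
  "reaches A t q \<Longrightarrow> (t, state_trm q) \<in> (rstep (bta_rules A))\<^sup>*"
proof (induction rule: reaches.induct)
  case (state q)
  then show ?case by (simp add: state_trm_def)
next
  case (trans f qs q ts)
  have "list_all2 (\<lambda>s t. (s, t) \<in> (rstep (bta_rules A))\<^sup>*) ts (map state_trm qs)"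
    using trans.IH by (auto simp: list_all2_map2 elim: list_all2_mono)
  from rsteps_args[OF this, of "Inl f" "[]"]
  have "(Fun (Inl f) ts, Fun (Inl f) (map state_trm qs)) \<in> (rstep (bta_rules A))\<^sup>*"
    by simp
  also have "(Fun (Inl f) (map state_trm qs), state_trm q) \<in> bta_rules A"
    using trans.hyps by (auto simp: bta_rules_def)
  from rstep.root[OF this, of Var]
  have "(Fun (Inl f) (map state_trm qs), state_trm q) \<in> rstep (bta_rules A)"
    by (simp add: comp_def)
  finally show ?case .
next
  case (eps t q q')
  have "(state_trm q, state_trm q') \<in> bta_rules A"
    using eps.hyps by (auto simp: bta_rules_def)
  from rstep.root[OF this, of Var]
  have "(state_trm q, state_trm q') \<in> rstep (bta_rules A)"
    by simp
  with eps.IH show ?case by (rule rtrancl_into_rtrancl)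
qed

lemma reaches_trans:
  "reaches A (Fun (Inr q) []) q' \<Longrightarrow> reaches A t q \<Longrightarrow> reaches A t q'"
proof (induction "Fun (Inr q) [] :: ('a + 'b, 'c) trm" q' rule: reaches.induct)
  case (eps q1 q2)
  from eps(2)[OF eps(4)] eps(3) show ?case by (rule reaches.eps)
qed simp_all

lemma reaches_arg:
  assumes "\<And>q. reaches A t q \<Longrightarrow> reaches A s q"
  shows "reaches A (Fun f (us @ t # vs)) q \<Longrightarrow> reaches A (Fun f (us @ s # vs)) q"
proof (induction "Fun f (us @ t # vs)" q rule: reaches.induct)
  case (trans g qs q)
  have "list_all2 (reaches A) (us @ t # vs) qs"
    using trans.hyps(2) by (rule list_all2_mono) simp
  then obtain qs1 q1 qs2 where "qs = qs1 @ q1 # qs2" "list_all2 (reaches A) us qs1"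
    "reaches A t q1" "list_all2 (reaches A) vs qs2"
    by (auto simp: list_all2_append1 list_all2_Cons1)
  then have "list_all2 (reaches A) (us @ s # vs) qs"
    using assms by (auto intro!: list_all2_appendI)
  from reaches.trans[OF trans.hyps(1) this] trans.hyps(3) show ?case by simp
next
  case (eps q q')
  then show ?case by (blast intro: reaches.eps)
qed simp

text \<open>Since \<open>reaches\<close> is preserved backwards along a step, a derivation can be
  traversed from its final state back to the initial term.\<close>

lemma reaches_rstep:
  "(s, t) \<in> rstep (bta_rules A) \<Longrightarrow> reaches A t q \<Longrightarrow> reaches A s q"
proof (induction arbitrary: q rule: rstep.induct)
  case (root l r \<sigma>)
  from root.hyps consider
    (transition) f qs q0 where "((f, qs), q0) \<in> set (transitions A)"
      "l = Fun (Inl f) (map state_trm qs)" "r = state_trm q0"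
  | (epsilon) q0 q1 where "(q0, q1) \<in> set (epsilons A)" "l = state_trm q0" "r = state_trm q1"
    by (auto simp: bta_rules_def)
  then show ?case
  proof cases
    case transition
    have "list_all2 (reaches A) (map (subst \<sigma> \<circ> state_trm) qs) qs"
      by (auto simp: list_all2_map1 state_trm_def list_all2_same intro: reaches.state)
    with transition have "reaches A (subst \<sigma> l) q0"
      by (auto intro: reaches.trans)
    then show ?thesis
      using reaches_trans[of A q0 q] root.prems transition(3) by (simp add: state_trm_def)
  next
    case epsilon
    then have "reaches A (subst \<sigma> l) q1"
      by (auto simp: state_trm_def intro: reaches.state reaches.eps)
    then show ?thesis
      using reaches_trans[of A q1 q] root.prems epsilon(3) by (simp add: state_trm_def)
  qed
next
  case (arg s t f us vs)
  show ?case using arg.IH arg.prems by (rule reaches_arg)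
qed

lemma rsteps_iff_reaches:
  "(t, state_trm q) \<in> (rstep (bta_rules A))\<^sup>* \<longleftrightarrow> reaches A t q"
proof
  assume "(t, state_trm q) \<in> (rstep (bta_rules A))\<^sup>*"
  then show "reaches A t q"
  proof (induction rule: converse_rtrancl_induct)
    case base
    then show ?case by (simp add: state_trm_def reaches.state)
  next
    case (step s u)
    then show ?case by (blast intro: reaches_rstep)
  qed
qed (rule rsteps_of_reaches)

text \<open>Paths longer than the number of pairs in \<open>E\<close> reach nothing new, so \<open>length E\<close> rounds suffice.\<close>

definition eps_closure :: "(nat \<times> nat) list \<Rightarrow> nat list \<Rightarrow> nat list" where
  "eps_closure E Q =
    rec_nat Q (\<lambda>_ Q. Q @ map snd (filter (\<lambda>e. fst e \<in> set Q) E)) (length E)"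

lemma set_eps_closure: "set (eps_closure E Q) = (set E)\<^sup>* `` set Q"
proof -
  have iter: "set (rec_nat Q (\<lambda>_ Q. Q @ map snd (filter (\<lambda>e. fst e \<in> set Q) E)) n)
    = (\<Union>k\<le>n. (set E ^^ k) `` set Q)" for n
  proof (induction n)
    case (Suc n)
    let ?U = "\<Union>k\<le>n. (set E ^^ k) `` set Q"
    have "(\<Union>k\<le>Suc n. (set E ^^ k) `` set Q) = set Q \<union> set E `` ?U"
      by (simp add: atMost_Suc_eq_insert_0 relcomp_Image Image_UN)
    moreover have "set Q \<subseteq> ?U"
      by (auto intro!: bexI[of _ 0])
    moreover have "?U \<subseteq> (\<Union>k\<le>Suc n. (set E ^^ k) `` set Q)"
      by (intro UN_mono) auto
    moreover have "V = U \<union> W" if "V = P \<union> W" "P \<subseteq> U" "U \<subseteq> V" for U V W P :: "nat set"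
      using that by blast
    ultimately have "(\<Union>k\<le>Suc n. (set E ^^ k) `` set Q) = ?U \<union> set E `` ?U"
      by presburger
    moreover have "snd ` {e \<in> set E. fst e \<in> ?U} = set E `` ?U"
      by force
    ultimately show ?case by (simp add: Suc)
  qed simp
  have "(set E)\<^sup>* = (\<Union>k\<le>length E. set E ^^ k)"
  proof
    show "(set E)\<^sup>* \<subseteq> (\<Union>k\<le>length E. set E ^^ k)"
      unfolding rtrancl_finite_eq_relpow[OF finite_set] using card_length[of E] by fastforce
  qed (auto intro: relpow_imp_rtrancl)
  then show ?thesis by (auto simp: eps_closure_def iter)
qed

text \<open>The subset construction, carried out on the fly for one term.\<close>

definition run :: "((nat \<times> nat list) \<times> nat) list \<Rightarrow> (nat \<times> nat) list \<Rightarrow> (nat, nat) trm \<Rightarrow> nat list" where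
  "run T E = tfold (\<lambda>_. []) (\<lambda>f Qs. eps_closure E
    (map snd (filter (\<lambda>\<rho>. fst (fst \<rho>) = f \<and> list_all2 (\<lambda>q Q. q \<in> set Q) (snd (fst \<rho>)) Qs) T)))"

text \<open>All uses of \<open>eps\<close> at the root come after a single use of
  \<open>trans\<close>, which is the shape that \<open>run\<close> evaluates.\<close>

lemma reaches_Fun_iff:
  "reaches A (Fun (Inl f) ts) q \<longleftrightarrow> (\<exists>qs q0. ((f, qs), q0) \<in> set (transitions A) \<and>
    list_all2 (reaches A) ts qs \<and> (q0, q) \<in> (set (epsilons A))\<^sup>*)"
proof
  assume "reaches A (Fun (Inl f) ts) q"
  then show "\<exists>qs q0. ((f, qs), q0) \<in> set (transitions A) \<and>
    list_all2 (reaches A) ts qs \<and> (q0, q) \<in> (set (epsilons A))\<^sup>*"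
  proof (induction "Fun (Inl f :: 'a + 'b) ts" q rule: reaches.induct)
    case (trans qs q)
    then have "list_all2 (reaches A) ts qs" by (auto elim: list_all2_mono)
    with trans show ?case by blast
  qed (blast intro: rtrancl_into_rtrancl)
next
  assume "\<exists>qs q0. ((f, qs), q0) \<in> set (transitions A) \<and>
    list_all2 (reaches A) ts qs \<and> (q0, q) \<in> (set (epsilons A))\<^sup>*"
  then obtain qs q0 where "((f, qs), q0) \<in> set (transitions A)" "list_all2 (reaches A) ts qs"
    and "(q0, q) \<in> (set (epsilons A))\<^sup>*" by blast
  from this(3,1,2) show "reaches A (Fun (Inl f) ts) q"
    by (induction rule: rtrancl_induct) (auto intro: reaches.trans reaches.eps)
qed

lemma not_reaches_Var: "\<not> reaches A (Var x) q"
proof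
  show "reaches A (Var x) q \<Longrightarrow> False"
    by (induction "Var x :: ('a + 'b, 'c) trm" q rule: reaches.induct) auto
qed

lemma set_run: "q \<in> set (run (transitions A) (epsilons A) t) \<longleftrightarrow> reaches A (map_trm Inl id t) q"
proof (induction t arbitrary: q)
  case (Var x)
  then show ?case by (simp add: run_def not_reaches_Var)
next
  case (Fun f ts)
  let ?run = "run (transitions A) (epsilons A)"
  have args: "list_all2 (\<lambda>q Q. q \<in> set Q) qs (map ?run ts) \<longleftrightarrow>
      list_all2 (reaches A) (map (map_trm Inl id) ts) qs" for qs
    using Fun.IH by (auto simp: list_all2_conv_all_nth id_def)
  have "q \<in> set (?run (Fun f ts)) \<longleftrightarrow> (\<exists>qs q0. ((f, qs), q0) \<in> set (transitions A) \<and>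
      list_all2 (\<lambda>q Q. q \<in> set Q) qs (map ?run ts) \<and> (q0, q) \<in> (set (epsilons A))\<^sup>*)"
    by (force simp: run_def set_eps_closure)
  then show ?case
    unfolding args by (simp add: reaches_Fun_iff id_def)
qed

section \<open>Reading an automaton off its code\<close>

definition code_hd :: "nat \<Rightarrow> nat" where
  "code_hd n = fst (prod_decode (n - 1))"

definition code_tl :: "nat \<Rightarrow> nat" where
  "code_tl n = snd (prod_decode (n - 1))"

lemma code_hd_tl [simp]:
  "code_hd (list_encode (x # xs)) = x" "code_tl (list_encode (x # xs)) = list_encode xs"
  by (simp_all add: code_hd_def code_tl_def)

definition transition_of_code :: "nat \<Rightarrow> (nat \<times> nat list) \<times> nat" where
  "transition_of_code n =
    ((code_hd n, list_decode (code_hd (code_tl n))), code_hd (code_tl (code_tl n)))"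

definition finals_of_code :: "nat \<Rightarrow> nat list" where
  "finals_of_code n = list_decode (code_hd (code_tl n))"

definition transitions_of_code :: "nat \<Rightarrow> ((nat \<times> nat list) \<times> nat) list" where
  "transitions_of_code n = map transition_of_code (list_decode (code_hd (code_tl (code_tl n))))"

definition epsilons_of_code :: "nat \<Rightarrow> (nat \<times> nat) list" where
  "epsilons_of_code n = map prod_decode (list_decode (code_hd (code_tl (code_tl (code_tl n)))))"

lemma of_bta_code [simp]:
  "finals_of_code (bta_code A) = finals A"
  "transitions_of_code (bta_code A) = transitions A"
  "epsilons_of_code (bta_code A) = epsilons A"
  by (simp_all add: finals_of_code_def transitions_of_code_def epsilons_of_code_def bta_code_def
      transition_of_code_def comp_def case_prod_beta del: list_encode.simps)

text \<open>The EPRF construction delivers a number, so acceptance has to be evaluated on codes of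
  automata.\<close>

definition accepts :: "nat \<Rightarrow> (nat, nat) trm \<Rightarrow> bool" where
  "accepts n t \<longleftrightarrow> list_ex (\<lambda>q. q \<in> set (run (transitions_of_code n) (epsilons_of_code n) t))
    (finals_of_code n)"

lemma accepts_bta_code: "t \<in> ground_terms \<Gamma> \<Longrightarrow> accepts (bta_code A) t \<longleftrightarrow> t \<in> bta_lang \<Gamma> A"
  by (simp add: accepts_def list_ex_iff set_run bta_lang_def rsteps_iff_reaches)

lemma cmp_code_hd [cmp_intros]: "cmp f \<Longrightarrow> cmp (\<lambda>x. code_hd (f x))"
  unfolding code_hd_def by (intro cmp_intros)

lemma cmp_code_tl [cmp_intros]: "cmp f \<Longrightarrow> cmp (\<lambda>x. code_tl (f x))"
  unfolding code_tl_def by (intro cmp_intros)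

lemma cmp_accepts [cmp_intros]:
  assumes "cmp f" "cmp t" shows "cmp (\<lambda>x. accepts (f x) (t x))"
proof -
  have "cmp (\<lambda>z. accepts (fst z) (snd z))"
    unfolding accepts_def run_def eps_closure_def finals_of_code_def transitions_of_code_def
      transition_of_code_def epsilons_of_code_def
    by (intro cmp_intros)
  from cmp_comp[OF this cmp_Pair[OF assms]] show ?thesis by simp
qed

lemma cmp_Fun [cmp_intros]:
  assumes "cmp f" "cmp ts" shows "cmp (\<lambda>x. Fun (f x) (ts x))"
proof -
  have "cmp (\<lambda>x. Suc (prod_encode (enc (f x), enc (ts x)) + prod_encode (enc (f x), enc (ts x))))"
    by (intro cmp_intros assms)
  then show ?thesis
    by (rule cmp_computable[OF computable_id]) (simp add: enc_Fun)
qed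

section \<open>The decision procedure\<close>

lemma symbols_subset: "t \<in> terms \<Sigma> \<Longrightarrow> symbols t \<subseteq> \<Sigma>"
  by (induction rule: terms.induct) auto

lemma trs_sign_subset: "trs \<Sigma> R \<Longrightarrow> sign R \<subseteq> \<Sigma>"
  using symbols_subset by (fastforce simp: trs_def sign_def)

lemma trs_vars: "trs \<Sigma> R \<Longrightarrow> (l, r) \<in> R \<Longrightarrow> vars r \<subseteq> vars l"
  by (auto simp: trs_def)

lemma trs_terms: "trs \<Sigma> R \<Longrightarrow> (l, r) \<in> R \<Longrightarrow> l \<in> terms \<Sigma> \<and> r \<in> terms \<Sigma>"
  by (auto simp: trs_def)

lemma terms_mono: "t \<in> terms \<Sigma> \<Longrightarrow> \<Sigma> \<subseteq> \<Gamma> \<Longrightarrow> t \<in> terms \<Gamma>"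
  by (induction rule: terms.induct) (auto intro: terms.intros)

lemma ground_terms_subst:
  assumes "t \<in> terms \<Sigma>" "\<And>x. x \<in> vars t \<Longrightarrow> \<sigma> x \<in> ground_terms \<Sigma>"
  shows "subst \<sigma> t \<in> ground_terms \<Sigma>"
  using assms
proof (induction rule: terms.induct)
  case (2 f ts)
  then have "subst \<sigma> t \<in> ground_terms \<Sigma>" if "t \<in> set ts" for t
    using that by auto
  then show ?case
    using 2(1) by (auto simp: ground_terms_def intro!: terms.intros(2))
qed simp

lemma full_tree_ground:
  assumes "(g, n) \<in> \<Sigma>" "(a, 0) \<in> \<Sigma>" shows "full_tree g n a k \<in> ground_terms \<Sigma>"
proof -
  have "full_tree g n a k \<in> terms \<Sigma> \<and> vars (full_tree g n a k) = {}"
    using assms by (induction k) (auto intro!: terms.intros)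
  then show ?thesis by (simp add: ground_terms_def)
qed

lemma irreducible_full_tree:
  assumes "irreducible R (Fun a [])" "(g, n) \<notin> sign R"
  shows "irreducible R (full_tree g n a k)"
proof (induction k)
  case (Suc k)
  show ?case
    unfolding full_tree_simps
    using irreducible_imp_no_Var[OF assms(1)] assms(2) Suc by (intro irreducible_Fun) auto
qed (use assms(1) in simp)

section \<open>Reduction of the inclusion to the rules of S\<close>

lemma rsteps_inclusion_iff:
  fixes R S :: "('f, nat) rule set"
  assumes R: "trs \<Sigma> R" and S: "trs \<Sigma> S"
    and g: "g \<in> \<Sigma> - (sign R \<union> constants \<Sigma>)"
    and sharp: "sharp \<in> constants \<Sigma>" "irreducible R (Fun (fst sharp) [])"
  shows "(rstep S)\<^sup>* \<inter> ground_terms \<Sigma> \<times> ground_terms \<Sigma> \<subseteq>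
      (rstep R)\<^sup>* \<inter> ground_terms \<Sigma> \<times> ground_terms \<Sigma> \<longleftrightarrow> S \<subseteq> (rstep R)\<^sup>*"
proof
  assume "S \<subseteq> (rstep R)\<^sup>*"
  then have "(rstep S)\<^sup>* \<subseteq> (rstep R)\<^sup>*"
    by (intro rtrancl_subset_rtrancl rstep_subset_rsteps)
  then show "(rstep S)\<^sup>* \<inter> ground_terms \<Sigma> \<times> ground_terms \<Sigma> \<subseteq>
      (rstep R)\<^sup>* \<inter> ground_terms \<Sigma> \<times> ground_terms \<Sigma>"
    by blast
next
  assume incl: "(rstep S)\<^sup>* \<inter> ground_terms \<Sigma> \<times> ground_terms \<Sigma> \<subseteq>
      (rstep R)\<^sup>* \<inter> ground_terms \<Sigma> \<times> ground_terms \<Sigma>"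
  obtain h n where h: "g = (h, n)" "(h, n) \<in> \<Sigma>" "(h, n) \<notin> sign R" "0 < n"
    using g by (cases g) (auto simp: constants_def)
  obtain a where a: "(a, 0) \<in> \<Sigma>" "irreducible R (Fun a [])"
    using sharp by (cases sharp) (auto simp: constants_def)
  show "S \<subseteq> (rstep R)\<^sup>*"
  proof (rule subrelI)
    fix l r assume lr: "(l, r) \<in> S"
    \<comment> \<open>Exceeding the nesting in \<open>l\<close> and \<open>r\<close> puts both in
      the domain of injectivity; being positive gives every tree \<open>h\<close> as its
      root.\<close>
    define N where "N = Suc (max (nesting {(h, n)} l) (nesting {(h, n)} r))"
    define \<sigma> :: "nat \<Rightarrow> ('f, nat) trm" where "\<sigma> x = full_tree h n a (N * Suc x)" for x
    have "\<sigma> x \<in> ground_terms \<Sigma>" for x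
      unfolding \<sigma>_def by (intro full_tree_ground h a)
    then have "subst \<sigma> l \<in> ground_terms \<Sigma>" "subst \<sigma> r \<in> ground_terms \<Sigma>"
      using trs_terms[OF S lr] by (auto intro: ground_terms_subst)
    moreover have "(subst \<sigma> l, subst \<sigma> r) \<in> (rstep S)\<^sup>*"
      using rstep.root[OF lr] by blast
    ultimately have steps: "(subst \<sigma> l, subst \<sigma> r) \<in> (rstep R)\<^sup>*"
      using incl by blast
    show "(l, r) \<in> (rstep R)\<^sup>*"
    proof (rule rsteps_of_subst[where C = "{(h, n)}" and \<sigma> = \<sigma> and N = N])
      show "\<exists>f ts. \<sigma> x = Fun f ts \<and> (f, length ts) \<in> {(h, n)}" for x
        by (simp add: \<sigma>_def N_def)
      show "irreducible R (\<sigma> x)" for x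
        unfolding \<sigma>_def by (intro irreducible_full_tree a h)
      show "inj_on (subst \<sigma>) {u. nesting {(h, n)} u < N}"
        by (rule inj_on_subst_full_tree[OF h(4) \<sigma>_def])
    qed (use h steps trs_vars[OF R] in \<open>auto simp: N_def\<close>)
  qed
qed

lemma nesting_eq_0_iff: "nesting C t = 0 \<longleftrightarrow> symbols t \<inter> C = {}"
proof (induction t)
  case (Fun f ts)
  show ?case
  proof
    assume "nesting C (Fun f ts) = 0"
    then have "(f, length ts) \<notin> C" "\<And>t. t \<in> set ts \<Longrightarrow> nesting C t = 0"
      using nesting_arg_le[of _ ts C f] by (auto split: if_splits)
    then show "symbols (Fun f ts) \<inter> C = {}" using Fun.IH by auto
  next
    assume "symbols (Fun f ts) \<inter> C = {}"
    then have "(f, length ts) \<notin> C" "\<And>t. t \<in> set ts \<Longrightarrow> nesting C t \<le> 0"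
      using Fun.IH by auto
    then show "nesting C (Fun f ts) = 0"
      using nesting_Fun_le[of f ts C 0] by simp
  qed
qed simp

section \<open>Fresh constants in place of variables\<close>

definition freeze :: "nat \<Rightarrow> (nat, nat) trm \<Rightarrow> (nat, nat) trm" where
  "freeze m t = tfold (\<lambda>x. Fun (m + x) []) Fun t"

lemma freeze_eq_subst: "freeze m t = subst (\<lambda>x. Fun (m + x) []) t"
  by (induction t) (simp_all add: freeze_def cong: map_cong)

text \<open>The same \<open>m\<close> bounds the names in use and the variables: the new names start
  at \<open>m\<close>, and there are \<open>m\<close> of them.\<close>

definition add_constants :: "nat ranked list \<Rightarrow> nat \<Rightarrow> nat ranked list" where
  "add_constants \<Sigma> m = rec_nat \<Sigma> (\<lambda>x \<Gamma>. (m + x, 0) # \<Gamma>) m"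

lemma set_add_constants: "set (add_constants \<Sigma> m) = set \<Sigma> \<union> {(m + x, 0) | x. x < m}"
proof -
  have "set (rec_nat \<Sigma> (\<lambda>x \<Gamma>. (m + x, 0) # \<Gamma>) k) = set \<Sigma> \<union> {(m + x, 0) | x. x < k}" for k
    by (induction k) (auto simp: less_Suc_eq)
  then show ?thesis by (simp add: add_constants_def)
qed

lemma ranked_alphabet_add_constants:
  assumes "ranked_alphabet (set \<Sigma>)" "\<And>f k. (f, k) \<in> set \<Sigma> \<Longrightarrow> f < m"
  shows "ranked_alphabet (set (add_constants \<Sigma> m))"
  using assms unfolding ranked_alphabet_def single_valued_def set_add_constants
  by (fastforce simp flip: set_add_constants)

lemma freeze_ground:
  assumes "t \<in> terms (set \<Sigma>)" "\<And>x. x \<in> vars t \<Longrightarrow> x < m"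
  shows "freeze m t \<in> ground_terms (set (add_constants \<Sigma> m))"
  unfolding freeze_eq_subst
proof (rule ground_terms_subst)
  show "t \<in> terms (set (add_constants \<Sigma> m))"
    using assms(1) by (rule terms_mono) (auto simp: set_add_constants)
  show "Fun (m + x) [] \<in> ground_terms (set (add_constants \<Sigma> m))" if "x \<in> vars t" for x
    using assms(2)[OF that] by (auto simp: ground_terms_def set_add_constants intro!: terms.intros)
qed

text \<open>For lifting, \<open>rsteps_of_subst\<close> applies with \<open>N = 1\<close>: the
  domain of injectivity consists of the terms free of the new constants. The set \<open>?C\<close>
  has a constant for each variable because that lemma concerns all
  \<open>\<sigma> x\<close>.\<close>

lemma rsteps_freeze_iff:
  assumes R: "trs \<Sigma> R" and fresh: "\<And>f k. (f, k) \<in> \<Sigma> \<Longrightarrow> f < m"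
    and "s \<in> terms \<Sigma>" "t \<in> terms \<Sigma>" and no_Var: "\<And>x r. (Var x, r) \<notin> R"
  shows "(freeze m s, freeze m t) \<in> (rstep R)\<^sup>* \<longleftrightarrow> (s, t) \<in> (rstep R)\<^sup>*"
proof
  let ?C = "{(m + x, 0) | x. True}"
  let ?\<sigma> = "\<lambda>x. Fun (m + x) []"
  have disj: "\<Sigma> \<inter> ?C = {}" using fresh by fastforce
  assume "(freeze m s, freeze m t) \<in> (rstep R)\<^sup>*"
  then show "(s, t) \<in> (rstep R)\<^sup>*"
    unfolding freeze_eq_subst
  proof (rule rsteps_of_subst[where C = ?C and N = 1, rotated -1])
    show "?C \<inter> sign R = {}" using disj trs_sign_subset[OF R] by blast
    show "nesting ?C s < 1" "nesting ?C t < 1"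
      using disj symbols_subset[OF assms(3)] symbols_subset[OF assms(4)]
      by (auto simp: nesting_eq_0_iff)
    show "irreducible R (?\<sigma> x)" for x
      using no_Var fresh[of "m + x" 0] trs_sign_subset[OF R] by (intro irreducible_Fun) auto
    show "inj_on (subst ?\<sigma>) {u. nesting ?C u < 1}"
    proof (rule inj_on_substI)
      show "v = Var x" if "nesting ?C v < 1" "subst ?\<sigma> v = ?\<sigma> x" for v :: "(nat, nat) trm" and x
        using that by (cases v) auto
    qed
  qed (use trs_vars[OF R] in auto)
qed (simp add: freeze_eq_subst rsteps_subst)

text \<open>\<open>Suc (enc I)\<close> exceeds every symbol name and every variable of the instance \<open>I\<close>, so the new
  constants are fresh.\<close>

definition rules_simulated :: "(nat \<Rightarrow> nat) \<Rightarrow> nat ranked list \<times> (nat, nat) rule list \<Rightarrow> bool" where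
  "rules_simulated c I = list_all (\<lambda>\<rho>. accepts (c (prod_encode
      (enc (add_constants (fst I) (Suc (enc I))), enc [freeze (Suc (enc I)) (fst \<rho>)])))
      (freeze (Suc (enc I)) (snd \<rho>))) (snd I)"

lemma cmp_rules_simulated:
  assumes "computable c" shows "cmp (rules_simulated c)"
  unfolding rules_simulated_def add_constants_def freeze_def
  by (intro cmp_intros cmp_computable_nat[OF assms])

lemma vars_less_enc: "x \<in> vars t \<Longrightarrow> x < Suc (enc (t :: (nat, nat) trm))"
proof (induction t)
  case (Fun f ts)
  then obtain t where t: "t \<in> set ts" "x < Suc (enc t)" by auto
  then show ?case using enc_arg_less[OF t(1), of f] by simp
qed (simp add: enc_Var)

lemma enc_alphabet: "enc \<Sigma> = alphabet_code \<Sigma>"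
  by (simp add: enc_list_def alphabet_code_def enc_prod_def cong: map_cong)

lemma enc_trs: "enc S = trs_code S"
  by (simp add: enc_list_def trs_code_def enc_prod_def enc_trm case_prod_beta cong: map_cong)

lemma enc_trms: "enc L = trms_code L"
  by (simp add: enc_list_def trms_code_def enc_trm cong: map_cong)

theorem mainTheorem18:
  fixes R :: "(nat, nat) rule set"
  assumes "EPRF_TRS R"
  shows "decidable_on (\<lambda>(\<Sigma>, S). prod_encode (alphabet_code \<Sigma>, trs_code S))
    {(\<Sigma>, S). ranked_alphabet (set \<Sigma>) \<and> trs (set \<Sigma>) R \<and> trs (set \<Sigma>) (set S) \<and>
       (\<exists>g. g \<in> set \<Sigma> - (sign R \<union> constants (set \<Sigma>))) \<and>
       (\<exists>sharp. sharp \<in> constants (set \<Sigma>) \<and> irreducible R (Fun (fst sharp) []))}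
    (\<lambda>(\<Sigma>, S).
       (rstep (set S))\<^sup>* \<inter> ground_terms (set \<Sigma>) \<times> ground_terms (set \<Sigma>)
         \<subseteq> (rstep R)\<^sup>* \<inter> ground_terms (set \<Sigma>) \<times> ground_terms (set \<Sigma>))"
proof -
  obtain c where c: "computable c"
    and bta: "\<And>\<Gamma> L. ranked_alphabet (set \<Gamma>) \<Longrightarrow> sign R \<subseteq> set \<Gamma> \<Longrightarrow> set L \<subseteq> ground_terms (set \<Gamma>) \<Longrightarrow>
      \<exists>A. c (prod_encode (alphabet_code \<Gamma>, trms_code L)) = bta_code A \<and> bta_over (set \<Gamma>) A \<and>
        bta_lang (set \<Gamma>) A = descendants R (set L)"
    using assms unfolding EPRF_TRS_def by blast
  \<comment> \<open>One procedure for all instances: \<open>R\<close> is fixed and enters through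
    \<open>c\<close> alone.\<close>
  obtain d where d: "computable d" "\<And>I. d (enc I) = enc (rules_simulated c I)"
    using cmp_rules_simulated[OF c] by (rule cmpE) (rule that)
  have "d (prod_encode (alphabet_code \<Sigma>, trs_code S)) =
      (if (rstep (set S))\<^sup>* \<inter> ground_terms (set \<Sigma>) \<times> ground_terms (set \<Sigma>)
        \<subseteq> (rstep R)\<^sup>* \<inter> ground_terms (set \<Sigma>) \<times> ground_terms (set \<Sigma>) then 1 else 0)"
    if \<Sigma>: "ranked_alphabet (set \<Sigma>)" and R: "trs (set \<Sigma>) R" and S: "trs (set \<Sigma>) (set S)"
      and g: "g \<in> set \<Sigma> - (sign R \<union> constants (set \<Sigma>))"
      and sharp: "sharp \<in> constants (set \<Sigma>)" "irreducible R (Fun (fst sharp) [])" for \<Sigma> S g sharp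
  proof -
    define m where "m = Suc (enc (\<Sigma>, S))"
    define \<Gamma> where "\<Gamma> = add_constants \<Sigma> m"
    have fresh: "f < m" if "(f, k) \<in> set \<Sigma>" for f k
      using enc_elem_less[OF that] le_prod_encode_1[of f k] le_prod_encode_1[of "enc \<Sigma>" "enc S"]
      by (simp add: m_def)
    have "ranked_alphabet (set \<Gamma>)"
      unfolding \<Gamma>_def using \<Sigma> fresh by (rule ranked_alphabet_add_constants)
    moreover have "sign R \<subseteq> set \<Gamma>"
      using trs_sign_subset[OF R] by (auto simp: \<Gamma>_def set_add_constants)
    ultimately have lang: "\<exists>A. c (prod_encode (enc \<Gamma>, enc [s])) = bta_code A \<and>
        bta_lang (set \<Gamma>) A = descendants R {s}" if "s \<in> ground_terms (set \<Gamma>)" for s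
      using bta[of \<Gamma> "[s]"] that by (auto simp: enc_alphabet enc_trms)
    have "accepts (c (prod_encode (enc \<Gamma>, enc [freeze m l]))) (freeze m r) \<longleftrightarrow>
        (l, r) \<in> (rstep R)\<^sup>*" if lr: "(l, r) \<in> set S" for l r
    proof -
      have terms: "l \<in> terms (set \<Sigma>)" "r \<in> terms (set \<Sigma>)"
        using trs_terms[OF S lr] by auto
      have "enc l < m"
        using enc_elem_less[OF lr] le_prod_encode_1[of "enc l" "enc r"]
          le_prod_encode_2[of "enc S" "enc \<Sigma>"] by (simp add: m_def)
      then have vars_l: "x < m" if "x \<in> vars l" for x
        using vars_less_enc[OF that] by simp
      then have vars_r: "x < m" if "x \<in> vars r" for x
        using trs_vars[OF S lr] that by blast
      obtain A where A: "c (prod_encode (enc \<Gamma>, enc [freeze m l])) = bta_code A"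
        "bta_lang (set \<Gamma>) A = descendants R {freeze m l}"
        using lang freeze_ground[OF terms(1) vars_l] unfolding \<Gamma>_def by blast
      have "freeze m r \<in> ground_terms (set \<Gamma>)"
        using freeze_ground[OF terms(2) vars_r] unfolding \<Gamma>_def .
      then have "accepts (bta_code A) (freeze m r) \<longleftrightarrow> (freeze m l, freeze m r) \<in> (rstep R)\<^sup>*"
        by (simp add: accepts_bta_code A(2) descendants_def)
      also have "\<dots> \<longleftrightarrow> (l, r) \<in> (rstep R)\<^sup>*"
        using R fresh terms irreducible_imp_no_Var[OF sharp(2)] by (rule rsteps_freeze_iff)
      finally show ?thesis unfolding A(1) .
    qed
    then have "rules_simulated c (\<Sigma>, S) \<longleftrightarrow> set S \<subseteq> (rstep R)\<^sup>*"
      unfolding rules_simulated_def fst_conv snd_conv m_def[symmetric] \<Gamma>_def[symmetric] list_all_iff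
      by auto
    then show ?thesis
      using d(2)[of "(\<Sigma>, S)"] rsteps_inclusion_iff[OF R S g sharp]
      by (simp add: enc_alphabet enc_trs enc_bool_def)
  qed
  with d(1) show ?thesis
    unfolding decidable_on_def by (intro exI[of _ d]) auto
qed

end
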